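(* For $|q|<1$, the theta functions $\theta_2=\theta_2(q)$, $\theta_3=\theta_3(q)$, $\theta_4=\theta_4(q)$ and the Eisenstein series $P_2=P(q^2)$ satisfy the differential system $$q\frac{d}{dq}\theta_{3}^{4}=\frac{1}{3}\left(\theta_{2}^{8}-\theta_{4}^{8}+\theta_{3}^{4}P_{2}\right),\qquad q\frac{d}{dq}\theta_{4}^{4}=\frac{1}{3}\left(\theta_{2}^{8}-\theta_{3}^{8}+\theta_{4}^{4}P_{2}\right),$$ $$q\frac{d}{dq}\theta_{2}^{4}=\frac{1}{3}\left(\theta_{3}^{8}-\theta_{4}^{8}+\theta_{2}^{4}P_{2}\right),\qquad q\frac{d}{dq}P_{2}=\frac{2P_{2}^{2}-\theta_{2}^{8}-\theta_{3}^{8}-\theta_{4}^{8}}{12}.$$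
   Context: For $|q|<1$, $$\theta_{3}(q)=\sum_{n=-\infty}^{\infty}q^{n^{2}},\qquad \theta_{4}(q)=\sum_{n=-\infty}^{\infty}(-1)^{n}q^{n^{2}},\qquad \theta_{2}(q)=\sum_{n=-\infty}^{\infty}q^{(n+1/2)^{2}},$$ so that $\theta_2^4(q)=16q\left(\sum_{n\ge 0}q^{n(n+1)}\right)^4$ is a power series in $q$. Also $$P(q)=1-24\sum_{j=1}^{\infty}\frac{jq^{j}}{1-q^{j}},\qquad P_n=P(q^n).$$ *)

theory Defs
  imports "HOL-Analysis.Analysis"
begin

text \<open>
  The powers \<open>q\<^bsup>(n+1/2)\<^sup>2\<^esup>\<close> are taken on the principal branch (and are \<open>0\<close> for \<open>q = 0\<close>). All of
  them equal \<open>q powr (1/4) * q ^ (n * (n + 1))\<close>, so changing the branch multiplies \<open>theta2 q\<close>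
  by a fourth root of unity, and \<open>theta2 q ^ 4\<close> does not depend on the branch.
\<close>
definition theta2 :: "complex \<Rightarrow> complex" where
  "theta2 q = (\<Sum>\<^sub>\<infinity>n\<in>(UNIV :: int set). q powr ((of_int n + 1/2) ^ 2))"

definition theta3 :: "complex \<Rightarrow> complex" where
  "theta3 q = (\<Sum>\<^sub>\<infinity>n\<in>(UNIV :: int set). q powi (n ^ 2))"

definition theta4 :: "complex \<Rightarrow> complex" where
  "theta4 q = (\<Sum>\<^sub>\<infinity>n\<in>(UNIV :: int set). (-1) powi n * q powi (n ^ 2))"

definition eisP :: "complex \<Rightarrow> complex" where
  "eisP q = 1 - 24 * (\<Sum>\<^sub>\<infinity>j\<in>{1::nat..}. of_nat j * q ^ j / (1 - q ^ j))"

definition eisP_at :: "nat \<Rightarrow> complex \<Rightarrow> complex" where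
  "eisP_at n q = eisP (q ^ n)"

end

theory Submission
  imports Defs "HOL-Complex_Analysis.Complex_Analysis"
begin

text \<open>
  The proof replaces modular forms by the substitution \<open>q \<mapsto> q\<^sup>2\<close>. The Landen identities
  \<open>\<theta>\<^sub>3(q)\<^sup>2 + \<theta>\<^sub>4(q)\<^sup>2 = 2\<theta>\<^sub>3(q\<^sup>2)\<^sup>2\<close>, \<open>\<theta>\<^sub>3(q)\<^sup>2 - \<theta>\<^sub>4(q)\<^sup>2 = 2\<theta>\<^sub>2(q\<^sup>2)\<^sup>2\<close>,
  \<open>\<theta>\<^sub>3(q)\<theta>\<^sub>4(q) = \<theta>\<^sub>4(q\<^sup>2)\<^sup>2\<close>, \<open>\<theta>\<^sub>2(q)\<^sup>2 = 2\<theta>\<^sub>2(q\<^sup>2)\<theta>\<^sub>3(q\<^sup>2)\<close> give Jacobi's identity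
  \<open>\<theta>\<^sub>3\<^sup>4 = \<theta>\<^sub>4\<^sup>4 + \<theta>\<^sub>2\<^sup>4\<close> and show that a theta function cannot vanish in the disc, since a zero at \<open>q\<close>
  would propagate to \<open>q\<^sup>2, q\<^sup>4, \<dots> \<rightarrow> 0\<close>. Let \<open>L\<^sub>i = q \<theta>\<^sub>i' / \<theta>\<^sub>i\<close>. Differentiating the Landen identities shows
  that \<open>4(L\<^sub>3 - L\<^sub>4) / \<theta>\<^sub>2\<^sup>4\<close> is invariant under \<open>q \<mapsto> q\<^sup>2\<close>, hence equal to its value \<open>1\<close> at \<open>0\<close>.
  Gauss's product \<open>\<theta>\<^sub>4(q) = \<phi>(q)\<^sup>2 / \<phi>(q\<^sup>2)\<close>, with \<open>\<phi>(q) = \<Prod>(1 - q\<^sup>k)\<close>, gives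
  \<open>12 L\<^sub>4 = P(q) - P(q\<^sup>2)\<close>; therefore \<open>12 L\<^sub>4 + 2\<theta>\<^sub>3\<^sup>4 - \<theta>\<^sub>4\<^sup>4 - P(q\<^sup>2)\<close> is invariant as well, hence \<open>0\<close>. These
  two facts are the first three equations. The defect \<open>K\<close> of the last equation vanishes at \<open>0\<close> and
  satisfies \<open>K(q) = 4 K(q\<^sup>2)\<close>, so it vanishes because \<open>K(z) = O(z)\<close> near \<open>0\<close>
  and \<open>q\<close>, \<open>q\<^sup>2\<close>, \<open>q\<^sup>4\<close>, \<open>\<dots>\<close> decays faster than any geometric sequence.
\<close>

section \<open>Series over the integers\<close>

text \<open>The common majorant of all theta series. Its exponent is \<open>nat |n| - 1\<close>
  rather than \<open>nat |n|\<close> because \<open>n * (n + 1)\<close> vanishes already at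
  \<open>n = -1\<close>; truncated subtraction gives exponent 0 at \<open>n = 0\<close>.\<close>

lemma summable_on_int_power_abs:
  fixes r :: real
  assumes "0 \<le> r" "r < 1"
  shows "(\<lambda>n::int. r ^ (nat \<bar>n\<bar> - 1)) summable_on UNIV"
proof -
  have s: "(\<lambda>n::nat. r ^ (n - 1)) summable_on UNIV"
  proof (rule summable_nonneg_imp_summable_on)
    have "summable (\<lambda>n. r ^ (Suc n - 1))" using assms by (simp add: summable_geometric)
    thus "summable (\<lambda>n::nat. r ^ (n - 1))" by (subst (asm) summable_Suc_iff)
  qed (use assms in auto)
  have "(\<lambda>n::int. r ^ (nat \<bar>n\<bar> - 1)) summable_on (range int)"
    by (subst summable_on_reindex) (use s in \<open>auto simp: o_def\<close>)
  moreover have "(\<lambda>n::int. r ^ (nat \<bar>n\<bar> - 1)) summable_on (range (\<lambda>n. - int n))"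
    by (subst summable_on_reindex) (use s in \<open>auto simp: o_def inj_on_def\<close>)
  ultimately have "(\<lambda>n::int. r ^ (nat \<bar>n\<bar> - 1)) summable_on (range int \<union> range (\<lambda>n. - int n))"
    by (rule summable_on_union)
  moreover have "range int \<union> range (\<lambda>n. - int n) = UNIV"
  proof -
    have "x \<in> range int \<union> range (\<lambda>n. - int n)" for x
      by (cases x rule: int_cases2) auto
    thus ?thesis by auto
  qed
  ultimately show ?thesis by simp
qed

lemma norm_int_series_term_le:
  fixes q :: complex
  assumes "norm q \<le> r" "r < 1" "nat \<bar>n\<bar> - 1 \<le> e n" "norm (c n) \<le> 1"
  shows "norm (c n * q ^ e n) \<le> r ^ (nat \<bar>n::int\<bar> - 1)"
proof -
  have r: "0 \<le> r" using assms(1) norm_ge_zero order_trans by blast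
  have "norm (c n * q ^ e n) \<le> 1 * norm q ^ e n"
    unfolding norm_mult norm_power using assms by (intro mult_right_mono) auto
  also have "\<dots> \<le> r ^ e n" using assms by (simp add: power_mono)
  also have "\<dots> \<le> r ^ (nat \<bar>n\<bar> - 1)" using assms r by (intro power_decreasing) auto
  finally show ?thesis .
qed

lemma int_series_abs_summable:
  fixes q :: complex
  assumes "norm q < 1" "\<And>n::int. nat \<bar>n\<bar> - 1 \<le> e n" "\<And>n. norm (c n) \<le> 1"
  shows "(\<lambda>n. norm (c n * q ^ e n)) summable_on UNIV"
  by (rule summable_on_comparison_test[OF summable_on_int_power_abs[of "norm q"]])
     (use assms norm_int_series_term_le[of q "norm q" _ e c] in auto)

text \<open>On each disc of radius \<open>r < 1\<close> the majorant makes the finite partial sums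
  converge uniformly, so holomorphy passes to the limit; these discs exhaust the unit disc.\<close>

lemma int_series_holomorphic:
  assumes "\<And>n::int. nat \<bar>n\<bar> - 1 \<le> e n" "\<And>n. norm (c n :: complex) \<le> 1"
  shows "(\<lambda>q. \<Sum>\<^sub>\<infinity>n. c n * q ^ e n) holomorphic_on ball 0 1"
proof -
  have "(\<lambda>q. \<Sum>\<^sub>\<infinity>n. c n * q ^ e n) holomorphic_on ball 0 r" if r: "0 < r" "r < 1" for r
  proof (rule holomorphic_uniform_limit)
    show "uniform_limit (cball 0 r) (\<lambda>X q. \<Sum>n\<in>X. c n * q ^ e n) (\<lambda>q. \<Sum>\<^sub>\<infinity>n. c n * q ^ e n)
            (finite_subsets_at_top UNIV)"
      by (rule Weierstrass_m_test_general[OF _ summable_on_int_power_abs[of r]])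
         (use r assms norm_int_series_term_le[of _ r _ e c] in auto)
  qed (auto intro!: always_eventually continuous_intros holomorphic_intros)
  moreover have "ball 0 1 = (\<Union>r\<in>{0<..<1}. ball (0::complex) r)"
  proof (intro equalityI subsetI)
    fix x :: complex assume "x \<in> ball 0 1"
    then obtain r where "norm x < r" "r < 1" using dense[of "norm x" 1] by auto
    moreover from this have "0 < r" using norm_ge_zero[of x] by linarith
    ultimately show "x \<in> (\<Union>r\<in>{0<..<1}. ball 0 r)" by (intro UN_I[of r]) auto
  qed auto
  ultimately show ?thesis by (auto intro!: holomorphic_on_UN_open)
qed

lemma infsum_mult_infsum:
  fixes f :: "'a \<Rightarrow> complex" and g :: "'b \<Rightarrow> complex"
  assumes "(\<lambda>x. norm (f x)) summable_on UNIV" "(\<lambda>x. norm (g x)) summable_on UNIV"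
  shows "(\<lambda>(x,y). f x * g y) summable_on UNIV"
    and "infsum f UNIV * infsum g UNIV = (\<Sum>\<^sub>\<infinity>(x,y). f x * g y)"
proof -
  have "(\<lambda>(x,y). norm (f x) * norm (g y)) summable_on UNIV \<times> UNIV"
    by (rule summable_on_SigmaI[where g = "\<lambda>x. norm (f x) * (\<Sum>\<^sub>\<infinity>y. norm (g y))"])
       (use assms in \<open>auto intro!: has_sum_cmult_right has_sum_infsum summable_on_cmult_left\<close>)
  hence "(\<lambda>p. norm ((\<lambda>(x,y). f x * g y) p)) summable_on UNIV"
    by (simp add: case_prod_unfold norm_mult)
  thus s: "(\<lambda>(x,y). f x * g y) summable_on UNIV"
    by (rule abs_summable_summable)
  have "(\<Sum>\<^sub>\<infinity>(x,y)\<in>UNIV \<times> UNIV. f x * g y) = (\<Sum>\<^sub>\<infinity>x. \<Sum>\<^sub>\<infinity>y. f x * g y)"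
    using s by (subst infsum_Sigma'_banach) auto
  thus "infsum f UNIV * infsum g UNIV = (\<Sum>\<^sub>\<infinity>(x,y). f x * g y)"
    by (simp add: infsum_cmult_right' infsum_cmult_left')
qed

text \<open>Pairs of integers with even sum are exactly \<open>(i + j, i - j)\<close>, those with
  odd sum exactly \<open>(i + j + 1, i - j)\<close>. Every Landen identity comes from this
  substitution, which turns \<open>m^2 + n^2\<close> into twice a form of the same kind, up to a
  constant.\<close>

lemma infsum_int_pairs_by_parity:
  fixes F :: "int \<times> int \<Rightarrow> complex"
  assumes "F summable_on UNIV"
  shows "infsum F UNIV = (\<Sum>\<^sub>\<infinity>(i,j). F (i + j, i - j)) + (\<Sum>\<^sub>\<infinity>(i,j). F (i + j + 1, i - j))"
proof -
  let ?g = "\<lambda>(i::int,j). (i + j, i - j)" and ?h = "\<lambda>(i::int,j). (i + j + 1, i - j)"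
  have g: "inj ?g" and h: "inj ?h" by (auto simp: inj_on_def)
  have "x \<in> range ?g \<union> range ?h" for x
  proof (cases x)
    case (Pair m n)
    show ?thesis
    proof (cases "even (m + n)")
      case True
      hence "x = ?g ((m + n) div 2, (m - n) div 2)" unfolding Pair by (auto elim!: evenE) presburger+
      thus ?thesis by blast
    next
      case False
      hence "x = ?h ((m + n - 1) div 2, (m - n - 1) div 2)" unfolding Pair by simp presburger
      thus ?thesis by blast
    qed
  qed
  hence U: "UNIV = range ?g \<union> range ?h" by blast
  have D: "range ?g \<inter> range ?h = {}" by auto presburger
  have "infsum F UNIV = infsum F (range ?g) + infsum F (range ?h)"
    by (subst U, rule infsum_Un_disjoint) (use assms D in \<open>auto intro: summable_on_subset_banach\<close>)
  thus ?thesis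
    unfolding infsum_reindex[OF g] infsum_reindex[OF h] by (simp add: o_def case_prod_unfold)
qed

section \<open>Landen transformations of the theta functions\<close>

text \<open>This is \<open>\<theta>\<^sub>2(q) / q\<^bsup>1/4\<^esup>\<close>, which unlike \<open>\<theta>\<^sub>2\<close> itself is holomorphic in the disc.\<close>
definition theta2_reduced :: "complex \<Rightarrow> complex" where
  "theta2_reduced q = (\<Sum>\<^sub>\<infinity>n\<in>(UNIV :: int set). q ^ nat (n * (n + 1)))"

lemma abs_minus_1_le_square: "nat \<bar>n::int\<bar> - 1 \<le> nat (n ^ 2)"
proof -
  have "\<bar>n\<bar> * 1 \<le> \<bar>n\<bar> * \<bar>n\<bar>" if "n \<noteq> 0" using that by (intro mult_left_mono) auto
  hence "\<bar>n\<bar> \<le> n ^ 2" by (cases "n = 0") (auto simp: power2_eq_square)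
  thus ?thesis by linarith
qed

lemma abs_minus_1_le_pronic: "nat \<bar>n::int\<bar> - 1 \<le> nat (n * (n + 1))"
proof (cases "n \<ge> 0")
  case True
  hence "n * 1 \<le> n * (n + 1)" by (intro mult_left_mono) auto
  with True show ?thesis by linarith
next
  case False
  hence "(-n - 1) * 1 \<le> (-n - 1) * (-n)" by (intro mult_left_mono) auto
  also have "\<dots> = n * (n + 1)" by (simp add: algebra_simps)
  finally have "nat (- n - 1) \<le> nat (n * (n + 1))" by (simp only: nat_mono mult_1_right)
  moreover have "nat \<bar>n\<bar> - 1 = nat (- n - 1)" using False by linarith
  ultimately show ?thesis by simp
qed

lemma pronic_nonneg: "n * (n + 1) \<ge> (0::int)"
  by (cases "n \<ge> 0") (auto simp: mult_nonneg_nonneg mult_nonpos_nonpos)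

lemma theta3_eq: "theta3 q = (\<Sum>\<^sub>\<infinity>n. 1 * q ^ nat (n ^ 2))"
  unfolding theta3_def by (simp add: power_int_def)

lemma theta4_eq: "theta4 q = (\<Sum>\<^sub>\<infinity>n. (-1) powi n * q ^ nat (n ^ 2))"
  unfolding theta4_def by (simp add: power_int_def)

lemma theta2_reduced_eq: "theta2_reduced q = (\<Sum>\<^sub>\<infinity>n. 1 * q ^ nat (n * (n + 1)))"
  by (simp add: theta2_reduced_def)

lemma norm_minus_one_powi: "norm ((-1) powi n :: complex) \<le> 1"
  by (simp add: norm_power_int)

lemma holomorphic_theta3: "theta3 holomorphic_on ball 0 1"
  unfolding theta3_eq[abs_def]
  by (rule int_series_holomorphic) (use abs_minus_1_le_square in auto)

lemma holomorphic_theta4: "theta4 holomorphic_on ball 0 1"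
  unfolding theta4_eq[abs_def]
  by (rule int_series_holomorphic) (use abs_minus_1_le_square norm_minus_one_powi in auto)

lemma holomorphic_theta2_reduced: "theta2_reduced holomorphic_on ball 0 1"
  unfolding theta2_reduced_eq[abs_def]
  by (rule int_series_holomorphic) (use abs_minus_1_le_pronic in auto)

lemma infsum_finite_support:
  fixes f :: "'a \<Rightarrow> complex"
  assumes "finite A" "\<And>x. x \<notin> A \<Longrightarrow> f x = 0"
  shows "infsum f UNIV = sum f A"
proof -
  have "infsum f UNIV = infsum f A" by (rule infsum_cong_neutral) (use assms in auto)
  thus ?thesis using assms by simp
qed

lemma theta3_0 [simp]: "theta3 0 = 1"
  unfolding theta3_eq by (subst infsum_finite_support[of "{0}"]) auto

lemma theta4_0 [simp]: "theta4 0 = 1"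
  unfolding theta4_eq by (subst infsum_finite_support[of "{0}"]) auto

lemma theta2_reduced_0 [simp]: "theta2_reduced 0 = 2"
proof -
  have "(0::complex) ^ nat (n * (n + 1)) = 0" if "n \<notin> {0, -1}" for n :: int
  proof -
    have "n * (n + 1) \<noteq> 0" using that by auto
    thus ?thesis using pronic_nonneg[of n] by (simp add: power_0_left)
  qed
  thus ?thesis unfolding theta2_reduced_def
    by (subst infsum_finite_support[of "{0, -1}"]) auto
qed

text \<open>Because \<open>(n + 1/2)^2 = 1/4 + n(n + 1)\<close>, the factor
  \<open>q powr (1/4)\<close> leaves the sum, and its fourth power is \<open>q\<close>. From here on
  the branch disappears.\<close>

lemma theta2_pow4: "theta2 q ^ 4 = q * theta2_reduced q ^ 4"
proof (cases "q = 0")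
  case True
  thus ?thesis by (simp add: theta2_def)
next
  case False
  have "q powr ((of_int n + 1/2) ^ 2) = q powr (1/4) * q ^ nat (n * (n + 1))" for n :: int
  proof -
    have "(of_int n + 1/2 :: complex) ^ 2 = 1/4 + of_int (n * (n + 1))"
      by (simp add: power2_eq_square algebra_simps)
    also have "of_int (n * (n + 1)) = (of_nat (nat (n * (n + 1))) :: complex)"
      using pronic_nonneg[of n] by (metis of_int_of_nat_eq int_nat_eq)
    finally show ?thesis using False by (simp add: powr_add powr_nat')
  qed
  hence "theta2 q = q powr (1/4) * theta2_reduced q"
    unfolding theta2_def theta2_reduced_def by (simp add: infsum_cmult_right')
  moreover have "(q powr (1/4)) ^ 4 = q"
    using False by (simp add: powr_def flip: exp_of_nat_mult)
  ultimately show ?thesis by (simp add: power_mult_distrib)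
qed

section \<open>Products of two integer series and the arithmetic of their exponents\<close>

lemma int_series_mult_by_parity:
  fixes q :: complex
  assumes "norm q < 1" "\<And>n::int. nat \<bar>n\<bar> - 1 \<le> e n" "\<And>n. norm (c n) \<le> 1"
    "\<And>n::int. nat \<bar>n\<bar> - 1 \<le> e' n" "\<And>n. norm (c' n) \<le> 1"
  shows "(\<Sum>\<^sub>\<infinity>n. c n * q ^ e n) * (\<Sum>\<^sub>\<infinity>n. c' n * q ^ e' n) =
    (\<Sum>\<^sub>\<infinity>(i,j). c (i + j) * c' (i - j) * q ^ (e (i + j) + e' (i - j))) +
    (\<Sum>\<^sub>\<infinity>(i,j). c (i + j + 1) * c' (i - j) * q ^ (e (i + j + 1) + e' (i - j)))"
proof -
  note s = int_series_abs_summable[of q e c, OF assms(1-3)]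
    int_series_abs_summable[of q e' c', OF assms(1,4,5)]
  show ?thesis unfolding infsum_mult_infsum(2)[OF s]
    by (subst infsum_int_pairs_by_parity[OF infsum_mult_infsum(1)[OF s]])
       (simp add: power_add mult_ac case_prod_unfold)
qed

lemma int_series_mult:
  fixes q :: complex
  assumes "norm q < 1" "\<And>n::int. nat \<bar>n\<bar> - 1 \<le> e n" "\<And>n. norm (c n) \<le> 1"
    "\<And>n::int. nat \<bar>n\<bar> - 1 \<le> e' n" "\<And>n. norm (c' n) \<le> 1"
  shows "(\<Sum>\<^sub>\<infinity>n. c n * q ^ e n) * (\<Sum>\<^sub>\<infinity>n. c' n * q ^ e' n) =
    (\<Sum>\<^sub>\<infinity>(i,j). c i * c' j * q ^ (e i + e' j))"
  unfolding infsum_mult_infsum(2)[OF int_series_abs_summable[of q e c, OF assms(1-3)]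
    int_series_abs_summable[of q e' c', OF assms(1,4,5)]]
  by (simp add: power_add mult_ac case_prod_unfold)

lemma norm_power2_less_one: "norm q < 1 \<Longrightarrow> norm (q\<^sup>2) < 1" for q :: complex
  by (simp add: norm_power power_less_one_iff)

lemma exponents_square_even:
  "nat ((i + j)\<^sup>2) + nat ((i - j)\<^sup>2) = 2 * (nat (i\<^sup>2) + nat (j\<^sup>2))" for i j :: int
proof -
  have "(i + j)\<^sup>2 + (i - j)\<^sup>2 = 2 * (i\<^sup>2 + j\<^sup>2)" by (simp add: power2_eq_square algebra_simps)
  thus ?thesis by (simp flip: nat_add_distrib)
qed

lemma exponents_square_odd:
  "nat ((i + j + 1)\<^sup>2) + nat ((i - j)\<^sup>2) = 1 + 2 * (nat (i * (i + 1)) + nat (j * (j + 1)))"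
  for i j :: int
proof -
  have "(i + j + 1)\<^sup>2 + (i - j)\<^sup>2 = 1 + 2 * (i * (i + 1) + j * (j + 1))"
    by (simp add: power2_eq_square algebra_simps)
  moreover have "nat (1 + 2 * (a + b)) = 1 + 2 * (nat a + nat b)" if "a \<ge> 0" "b \<ge> 0" for a b :: int
    using that by (simp add: nat_add_distrib nat_mult_distrib)
  note this[OF pronic_nonneg[of i] pronic_nonneg[of j]]
  ultimately show ?thesis by (simp flip: nat_add_distrib)
qed

lemma exponents_pronic_even:
  "nat ((i + j) * (i + j + 1)) + nat ((i - j) * (i - j + 1)) = 2 * (nat (i * (i + 1)) + nat (j\<^sup>2))"
  for i j :: int
proof -
  have "(i + j) * (i + j + 1) + (i - j) * (i - j + 1) = 2 * (i * (i + 1) + j\<^sup>2)"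
    by (simp add: power2_eq_square algebra_simps)
  moreover have "nat (2 * (i * (i + 1) + j\<^sup>2)) = 2 * (nat (i * (i + 1)) + nat (j\<^sup>2))"
    using pronic_nonneg[of i] by (simp add: nat_mult_distrib nat_add_distrib)
  ultimately show ?thesis
    using pronic_nonneg[of "i + j"] pronic_nonneg[of "i - j"] by (simp flip: nat_add_distrib)
qed

lemma norm_one_le: "norm (1::complex) \<le> 1"
  by simp

lemma theta3_squared_eq_double_sum:
  assumes "norm q < 1"
  shows "theta3 q ^ 2 = (\<Sum>\<^sub>\<infinity>(i,j). q ^ (nat (i\<^sup>2) + nat (j\<^sup>2)))"
  using int_series_mult[of q "\<lambda>n. nat (n\<^sup>2)" "\<lambda>_. 1" "\<lambda>n. nat (n\<^sup>2)" "\<lambda>_. 1",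
      OF assms abs_minus_1_le_square norm_one_le abs_minus_1_le_square norm_one_le]
  by (simp add: theta3_eq power2_eq_square[of "infsum _ _"])

lemma theta2_reduced_squared_eq_double_sum:
  assumes "norm q < 1"
  shows "theta2_reduced q ^ 2 = (\<Sum>\<^sub>\<infinity>(i,j). q ^ (nat (i * (i + 1)) + nat (j * (j + 1))))"
  using int_series_mult[of q "\<lambda>n. nat (n * (n + 1))" "\<lambda>_. 1" "\<lambda>n. nat (n * (n + 1))" "\<lambda>_. 1",
      OF assms abs_minus_1_le_pronic norm_one_le abs_minus_1_le_pronic norm_one_le]
  by (simp add: theta2_reduced_eq power2_eq_square[of "infsum _ _"])

text \<open>In the square of the series, pairs of even sum have exponent \<open>2(i^2 + j^2)\<close>
  and give \<open>theta3 (q^2) ^ 2\<close>; pairs of odd sum have exponent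
  \<open>1 + 2(i(i+1) + j(j+1))\<close> and give the other term.\<close>

lemma theta3_square:
  assumes "norm q < 1"
  shows "theta3 q ^ 2 = theta3 (q\<^sup>2) ^ 2 + q * theta2_reduced (q\<^sup>2) ^ 2"
proof -
  have "theta3 q ^ 2 = (\<Sum>\<^sub>\<infinity>(i,j). q ^ (nat ((i + j)\<^sup>2) + nat ((i - j)\<^sup>2))) +
          (\<Sum>\<^sub>\<infinity>(i,j). q ^ (nat ((i + j + 1)\<^sup>2) + nat ((i - j)\<^sup>2)))"
    using int_series_mult_by_parity[of q "\<lambda>n. nat (n\<^sup>2)" "\<lambda>_. 1" "\<lambda>n. nat (n\<^sup>2)" "\<lambda>_. 1",
        OF assms abs_minus_1_le_square norm_one_le abs_minus_1_le_square norm_one_le]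
    by (simp add: theta3_eq power2_eq_square[of "infsum _ _"])
  thus ?thesis
    unfolding theta3_squared_eq_double_sum[OF norm_power2_less_one[OF assms]]
      theta2_reduced_squared_eq_double_sum[OF norm_power2_less_one[OF assms]]
      exponents_square_even exponents_square_odd
    by (simp add: power_add power_mult case_prod_unfold infsum_cmult_right')
qed

text \<open>The same splitting as for \<open>theta3\<close>: the sign \<open>(-1)^(m+n)\<close> is
  constant on each parity class, so only the odd class changes sign.\<close>

lemma theta4_square:
  assumes "norm q < 1"
  shows "theta4 q ^ 2 = theta3 (q\<^sup>2) ^ 2 - q * theta2_reduced (q\<^sup>2) ^ 2"
proof -
  have "theta4 q ^ 2 =
      (\<Sum>\<^sub>\<infinity>(i,j). (-1) powi (i + j) * (-1) powi (i - j) * q ^ (nat ((i + j)\<^sup>2) + nat ((i - j)\<^sup>2))) +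
      (\<Sum>\<^sub>\<infinity>(i,j). (-1) powi (i + j + 1) * (-1) powi (i - j) *
         q ^ (nat ((i + j + 1)\<^sup>2) + nat ((i - j)\<^sup>2)))"
    using int_series_mult_by_parity[of q "\<lambda>n. nat (n\<^sup>2)" "\<lambda>n. (-1) powi n" "\<lambda>n. nat (n\<^sup>2)" "\<lambda>n. (-1) powi n",
        OF assms abs_minus_1_le_square norm_minus_one_powi abs_minus_1_le_square norm_minus_one_powi]
    by (simp add: theta4_eq power2_eq_square[of "infsum _ _"])
  also have "(\<lambda>(i,j). (-1) powi (i + j) * (-1) powi (i - j) * q ^ (nat ((i + j)\<^sup>2) + nat ((i - j)\<^sup>2))) =
      (\<lambda>(i,j). q ^ (nat ((i + j)\<^sup>2) + nat ((i - j)\<^sup>2)))"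
    by (auto simp: power_int_minus_left)
  also have "(\<lambda>(i,j). (-1) powi (i + j + 1) * (-1) powi (i - j) *
         q ^ (nat ((i + j + 1)\<^sup>2) + nat ((i - j)\<^sup>2))) =
      (\<lambda>(i,j). - (q ^ (nat ((i + j + 1)\<^sup>2) + nat ((i - j)\<^sup>2))))"
    by (auto simp: power_int_minus_left)
  finally show ?thesis
    unfolding theta3_squared_eq_double_sum[OF norm_power2_less_one[OF assms]]
      theta2_reduced_squared_eq_double_sum[OF norm_power2_less_one[OF assms]]
      exponents_square_even exponents_square_odd
    by (simp add: power_add power_mult case_prod_unfold infsum_cmult_right' infsum_uminus)
qed

text \<open>The reflection \<open>n -> -1 - n\<close> keeps \<open>n(n + 1)\<close> and flips the
  sign, so the sum is its own negative.\<close>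

lemma alternating_pronic_series_eq_0: "(\<Sum>\<^sub>\<infinity>n. (-1) powi n * q ^ nat (n * (n + 1)) :: complex) = 0"
proof -
  let ?f = "\<lambda>n::int. (-1) powi n * q ^ nat (n * (n + 1)) :: complex"
  have "infsum ?f UNIV = (\<Sum>\<^sub>\<infinity>n. - ?f n)"
    by (rule infsum_reindex_bij_witness[of _ "\<lambda>n. - 1 - n" "\<lambda>n. - 1 - n"])
       (auto simp: power_int_minus_left algebra_simps)
  thus ?thesis by (simp add: infsum_uminus)
qed

text \<open>The sign left in both parity classes is \<open>(-1)^(i-j) = (-1)^i (-1)^j\<close>, hence
  both double sums factor; the odd one factors into alternating pronic series, which vanish.\<close>

lemma theta3_mult_theta4:
  assumes "norm q < 1"
  shows "theta3 q * theta4 q = theta4 (q\<^sup>2) ^ 2"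
proof -
  note q2 = norm_power2_less_one[OF assms]
  let ?e = "\<lambda>(i,j). (-1) powi i * (-1) powi j * (q\<^sup>2) ^ (nat (i\<^sup>2) + nat (j\<^sup>2))"
  let ?o = "\<lambda>(i,j). (-1) powi i * (-1) powi j * (q\<^sup>2) ^ (nat (i * (i + 1)) + nat (j * (j + 1)))"
  have "theta3 q * theta4 q =
      (\<Sum>\<^sub>\<infinity>(i,j). (-1) powi (i - j) * q ^ (nat ((i + j)\<^sup>2) + nat ((i - j)\<^sup>2))) +
      (\<Sum>\<^sub>\<infinity>(i,j). (-1) powi (i - j) * q ^ (nat ((i + j + 1)\<^sup>2) + nat ((i - j)\<^sup>2)))"
    using int_series_mult_by_parity[of q "\<lambda>n. nat (n\<^sup>2)" "\<lambda>n. 1" "\<lambda>n. nat (n\<^sup>2)" "\<lambda>n. (-1) powi n",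
        OF assms abs_minus_1_le_square norm_one_le abs_minus_1_le_square norm_minus_one_powi]
    by (simp add: theta3_eq theta4_eq)
  also have "(\<lambda>(i,j). (-1) powi (i - j) * q ^ (nat ((i + j)\<^sup>2) + nat ((i - j)\<^sup>2))) = ?e"
    by (auto simp: exponents_square_even power_add power_mult power_int_minus_left)
  also have "(\<lambda>(i,j). (-1) powi (i - j) * q ^ (nat ((i + j + 1)\<^sup>2) + nat ((i - j)\<^sup>2))) =
      (\<lambda>p. q * ?o p)"
    by (auto simp: exponents_square_odd power_add power_mult power_int_minus_left)
  also have "infsum ?e UNIV = theta4 (q\<^sup>2) ^ 2"
    using int_series_mult[of "q\<^sup>2" "\<lambda>n. nat (n\<^sup>2)" "\<lambda>n. (-1) powi n" "\<lambda>n. nat (n\<^sup>2)" "\<lambda>n. (-1) powi n",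
        OF q2 abs_minus_1_le_square norm_minus_one_powi abs_minus_1_le_square norm_minus_one_powi]
    by (simp add: theta4_eq power2_eq_square[of "infsum _ _"])
  also have "(\<Sum>\<^sub>\<infinity>p. q * ?o p) = 0"
    using int_series_mult[of "q\<^sup>2" "\<lambda>n. nat (n * (n + 1))" "\<lambda>n. (-1) powi n" "\<lambda>n. nat (n * (n + 1))"
        "\<lambda>n. (-1) powi n", OF q2 abs_minus_1_le_pronic norm_minus_one_powi abs_minus_1_le_pronic norm_minus_one_powi]
    by (simp add: infsum_cmult_right' alternating_pronic_series_eq_0)
  finally show ?thesis by simp
qed

text \<open>Both parity classes contribute the same double sum, whence the factor 2.\<close>

lemma theta2_reduced_square:
  assumes "norm q < 1"
  shows "theta2_reduced q ^ 2 = 2 * theta2_reduced (q\<^sup>2) * theta3 (q\<^sup>2)"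
proof -
  let ?S = "\<Sum>\<^sub>\<infinity>(i,j). q ^ (2 * (nat (i * (i + 1)) + nat (j\<^sup>2)))"
  \<comment> \<open>Reflecting the second index by \<open>n -> -1 - n\<close> preserves its pronic
    exponent and exchanges the parity classes; the new parameters are \<open>j\<close> and
    \<open>i + 1\<close>.\<close>
  have swap: "nat ((i + j + 1) * (2 + (i + j))) + nat ((i - j) * (i - j + 1)) =
      2 * (nat (j * (j + 1)) + nat ((i + 1)\<^sup>2))" for i j :: int
  proof -
    have "(i - j) * (i - j + 1) = (j - (i + 1)) * (j - (i + 1) + 1)" by (simp add: algebra_simps)
    moreover have "(i + j + 1) * (2 + (i + j)) = (j + (i + 1)) * (j + (i + 1) + 1)"
      by (simp add: algebra_simps)
    ultimately show ?thesis by (simp only: exponents_pronic_even)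
  qed
  have "(\<Sum>\<^sub>\<infinity>(i,j). q ^ (nat ((i + j + 1) * (2 + (i + j))) + nat ((i - j) * (i - j + 1)))) = ?S"
    unfolding swap
    by (rule infsum_reindex_bij_witness[of _ "\<lambda>(j,i). (i - 1, j)" "\<lambda>(i,j). (j, i + 1)"]) auto
  moreover have "theta2_reduced (q\<^sup>2) * theta3 (q\<^sup>2) = ?S"
    using int_series_mult[of "q\<^sup>2" "\<lambda>n. nat (n * (n + 1))" "\<lambda>_. 1" "\<lambda>n. nat (n\<^sup>2)" "\<lambda>_. 1",
      OF norm_power2_less_one[OF assms] abs_minus_1_le_pronic norm_one_le abs_minus_1_le_square norm_one_le]
    by (simp add: theta3_eq theta2_reduced_eq power_mult power_add)
  moreover have "theta2_reduced q * theta2_reduced q = ?S +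
     (\<Sum>\<^sub>\<infinity>(i,j). q ^ (nat ((i + j + 1) * (2 + (i + j))) + nat ((i - j) * (i - j + 1))))"
    using int_series_mult_by_parity[of q "\<lambda>n. nat (n * (n + 1))" "\<lambda>_. 1" "\<lambda>n. nat (n * (n + 1))" "\<lambda>_. 1",
      OF assms abs_minus_1_le_pronic norm_one_le abs_minus_1_le_pronic norm_one_le]
    by (simp add: theta2_reduced_eq exponents_pronic_even)
  ultimately show ?thesis by (simp add: power2_eq_square)
qed

section \<open>The Euler product and its logarithmic derivative\<close>

text \<open>The q-Pochhammer symbol \<open>(q; q)_N\<close>; \<open>Suc k\<close> avoids the factor
  \<open>1 - q^0 = 0\<close>.\<close>

definition euler_partial :: "nat \<Rightarrow> complex \<Rightarrow> complex" where
  "euler_partial N q = (\<Prod>k<N. 1 - q ^ Suc k)"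

definition euler_phi :: "complex \<Rightarrow> complex" where
  "euler_phi q = (\<Prod>k. 1 - q ^ Suc k)"

lemma power_Suc_neq_one: "norm q < 1 \<Longrightarrow> q ^ Suc k \<noteq> 1" for q :: complex
  by (metis norm_one norm_power power_less_one_iff less_irrefl norm_ge_zero zero_less_Suc)

lemma euler_partial_nonzero: "norm q < 1 \<Longrightarrow> euler_partial N q \<noteq> 0"
  unfolding euler_partial_def using power_Suc_neq_one[of q] by (simp del: power_Suc)

lemma euler_convergent_prod:
  fixes q :: complex
  assumes "norm q < 1"
  shows "convergent_prod (\<lambda>k. 1 - q ^ Suc k)"
proof -
  have "summable (\<lambda>k. norm (1 - q ^ Suc k - 1))"
    using assms by (simp add: norm_mult norm_power summable_geometric summable_mult)
  thus ?thesis
    by (intro abs_convergent_prod_imp_convergent_prod summable_imp_abs_convergent_prod)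
qed

lemma euler_phi_nonzero: "norm q < 1 \<Longrightarrow> euler_phi q \<noteq> 0"
  unfolding euler_phi_def using power_Suc_neq_one[of q]
  by (intro prodinf_nonzero euler_convergent_prod) (auto simp del: power_Suc)

lemma euler_partial_tendsto:
  assumes "norm q < 1"
  shows "(\<lambda>N. euler_partial N q) \<longlonglongrightarrow> euler_phi q"
proof -
  have "(\<lambda>N. \<Prod>k\<le>N. 1 - q ^ Suc k) \<longlonglongrightarrow> euler_phi q"
    unfolding euler_phi_def by (rule convergent_prod_LIMSEQ[OF euler_convergent_prod[OF assms]])
  hence "(\<lambda>N. euler_partial (Suc N) q) \<longlonglongrightarrow> euler_phi q"
    by (simp add: euler_partial_def lessThan_Suc_atMost del: power_Suc)
  thus ?thesis by (rule filterlim_sequentially_Suc[THEN iffD1])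
qed

text \<open>The sums of \<open>|q|^k\<close> converge uniformly on the closed disc, and this passes
  to the products. Uniformity serves both the holomorphy of \<open>euler_phi\<close> and its
  termwise logarithmic derivative.\<close>

lemma euler_partial_uniform_limit:
  assumes "r < 1"
  shows "uniform_limit (cball 0 r) euler_partial euler_phi sequentially"
proof (cases "0 \<le> r")
  case True
  have "uniformly_convergent_on (cball 0 r) (\<lambda>N q::complex. \<Sum>n<N. norm (- (q ^ Suc n)))"
  proof (rule Weierstrass_m_test'[where M = "\<lambda>n. r ^ Suc n"])
    show "summable (\<lambda>n. r ^ Suc n)"
      using assms True by (simp add: summable_geometric summable_mult)
    show "norm (norm (- (x ^ Suc n))) \<le> r ^ Suc n" if "x \<in> cball 0 r" for x :: complex and n
      using that power_mono[of "norm x" r "Suc n"] by (simp add: norm_power norm_mult del: power_Suc)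
  qed
  hence "uniformly_convergent_on (cball 0 r) (\<lambda>N q::complex. \<Prod>n<N. 1 + (- (q ^ Suc n)))"
    by (intro uniformly_convergent_on_prod) (auto intro!: continuous_intros)
  then obtain l where l: "uniform_limit (cball 0 r) euler_partial l sequentially"
    by (auto simp: uniformly_convergent_on_def euler_partial_def[abs_def])
  have "l q = euler_phi q" if "q \<in> cball 0 r" for q
    using tendsto_uniform_limitI[OF l that] euler_partial_tendsto[of q] that assms
    by (intro LIMSEQ_unique[of "\<lambda>N. euler_partial N q"]) auto
  thus ?thesis using l by (subst uniform_limit_cong'[of _ _ euler_partial _ l]) auto
next
  case False
  hence "cball (0::complex) r = {}" by simp
  thus ?thesis by (simp only: uniform_limit_iff ball_empty) simp
qed

lemma euler_partial_holomorphic: "euler_partial N holomorphic_on A"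
  unfolding euler_partial_def[abs_def] by (intro holomorphic_intros)

lemma holomorphic_euler_phi: "euler_phi holomorphic_on ball 0 1"
proof (rule holomorphic_uniform_sequence[OF open_ball euler_partial_holomorphic])
  fix x :: complex assume x: "x \<in> ball 0 1"
  then obtain r where r: "norm x < r" "r < 1" using dense[of "norm x" 1] by auto
  have "cball x (r - norm x) \<subseteq> cball 0 r"
  proof
    fix y assume "y \<in> cball x (r - norm x)"
    thus "y \<in> cball 0 r" using norm_triangle_sub[of y x] by (auto simp: dist_norm norm_minus_commute)
  qed
  moreover have "cball (0::complex) r \<subseteq> ball 0 1" using r by auto
  ultimately show "\<exists>d>0. cball x d \<subseteq> ball 0 1 \<and> uniform_limit (cball x d) euler_partial euler_phi sequentially"
    using r uniform_limit_on_subset[OF euler_partial_uniform_limit[OF r(2)]]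
    by (intro exI[of _ "r - norm x"]) auto
qed

text \<open>The denominators satisfy \<open>|1 - q^(k+1)| >= 1 - |q|\<close>, which leaves the
  differentiated geometric series as majorant.\<close>

lemma lambert_abs_summable:
  fixes q :: complex
  assumes "norm q < 1"
  shows "summable (\<lambda>k. norm (of_nat (Suc k) * q ^ Suc k / (1 - q ^ Suc k)))"
proof (rule summable_comparison_test')
  have "summable (\<lambda>k. norm (of_nat (Suc k) * q ^ k))"
    using geometric_deriv_sums[of "norm q"] assms
    by (auto simp: norm_mult norm_power sums_iff simp del: of_nat_Suc)
  thus "summable (\<lambda>k. (1 / (1 - norm q)) * norm (of_nat (Suc k) * q ^ k))"
    by (rule summable_mult)
  fix k
  have "norm (q ^ Suc k) \<le> norm q"
    using assms power_decreasing[of 1 "Suc k" "norm q"] by (simp add: norm_power norm_mult)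
  hence "1 - norm q \<le> norm (1 - q ^ Suc k)"
    using norm_triangle_ineq2[of 1 "q ^ Suc k"] by simp
  moreover have "norm (of_nat (Suc k) * q ^ Suc k) \<le> norm (of_nat (Suc k) * q ^ k)"
    unfolding norm_mult norm_power using assms
    by (intro mult_left_mono power_decreasing) auto
  ultimately show "norm (norm (of_nat (Suc k) * q ^ Suc k / (1 - q ^ Suc k))) \<le>
      (1 / (1 - norm q)) * norm (of_nat (Suc k) * q ^ k)"
    using assms by (simp add: norm_divide frac_le del: of_nat_Suc power_Suc)
qed

text \<open>The factor \<open>1 - q^k\<close> contributes \<open>-k q^(k-1) / (1 - q^k)\<close> to
  the logarithmic derivative; multiplied by \<open>-q\<close> this is the Lambert term of
  \<open>eisP\<close>.\<close>

lemma eisP_eq_logderiv_euler_phi: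
  assumes "norm q < 1"
  shows "eisP q = 1 + 24 * q * deriv euler_phi q / euler_phi q"
proof -
  obtain r where r: "norm q < r" "r < 1" using dense[of "norm q" 1] assms by auto
  have *: "(\<lambda>k. deriv (\<lambda>q. 1 - q ^ Suc k) q / (1 - q ^ Suc k)) sums (deriv euler_phi q / euler_phi q)"
  proof (rule logderiv_prodinf_complex_uniform_limit[where A = "ball 0 r"])
    show "uniform_limit (ball 0 r) (\<lambda>n x. \<Prod>k<n. 1 - x ^ Suc k) euler_phi sequentially"
      using uniform_limit_on_subset[OF euler_partial_uniform_limit[OF r(2)] ball_subset_cball]
      by (simp add: euler_partial_def[abs_def])
  qed (use r euler_phi_nonzero assms in \<open>auto intro!: holomorphic_intros\<close>)
  have d: "deriv (\<lambda>q. 1 - q ^ Suc k) q = - (of_nat (Suc k) * q ^ k)" for k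
    by (rule DERIV_imp_deriv) (auto intro!: derivative_eq_intros simp del: power_Suc)
  have "(\<lambda>k. - q * (deriv (\<lambda>q. 1 - q ^ Suc k) q / (1 - q ^ Suc k))) sums
      (- q * (deriv euler_phi q / euler_phi q))"
    by (rule sums_mult[OF *])
  also have "(\<lambda>k. - q * (deriv (\<lambda>q. 1 - q ^ Suc k) q / (1 - q ^ Suc k))) =
      (\<lambda>k. of_nat (Suc k) * q ^ Suc k / (1 - q ^ Suc k))"
    unfolding d by (auto simp: mult_ac)
  finally have "((\<lambda>k. of_nat (Suc k) * q ^ Suc k / (1 - q ^ Suc k)) has_sum
      (- q * (deriv euler_phi q / euler_phi q))) UNIV"
    by (intro norm_summable_imp_has_sum lambert_abs_summable assms)
  hence "((\<lambda>j. of_nat j * q ^ j / (1 - q ^ j)) has_sum (- q * (deriv euler_phi q / euler_phi q))) (range Suc)"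
    by (subst has_sum_reindex) (auto simp: o_def)
  moreover have "range Suc = {1..}"
    by (auto simp: image_iff) (metis Suc_le_D)
  ultimately show ?thesis unfolding eisP_def by (simp add: infsumI)
qed

lemma holomorphic_eisP: "eisP holomorphic_on ball 0 1"
proof (rule holomorphic_transform)
  show "(\<lambda>q. 1 + 24 * q * deriv euler_phi q / euler_phi q) holomorphic_on ball 0 1"
    by (intro holomorphic_intros holomorphic_euler_phi) (use euler_phi_nonzero in auto)
qed (use eisP_eq_logderiv_euler_phi in auto)

section \<open>Gauss's product for \<open>\<theta>\<^sub>4\<close>\<close>

text \<open>
  Setting \<open>1 / (p; p)\<^sub>m = 0\<close> for \<open>m < 0\<close> makes the recurrence \<open>1 / (p; p)\<^bsub>m-1\<^esub> = (1 - p\<^sup>m) / (p; p)\<^sub>m\<close>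
  valid for every integer \<open>m\<close>, so that no boundary cases arise in sums over \<open>j\<close>.
\<close>
definition euler_partial_inverse :: "complex \<Rightarrow> int \<Rightarrow> complex" where
  "euler_partial_inverse p m = (if m < 0 then 0 else inverse (euler_partial (nat m) p))"

text \<open>The Gaussian binomial coefficient of \<open>2n\<close> over \<open>n + j\<close> in base
  \<open>p\<close>, centred so that it is supported on \<open>-n <= j <= n\<close>.\<close>

definition gauss_binomial :: "complex \<Rightarrow> nat \<Rightarrow> int \<Rightarrow> complex" where
  "gauss_binomial p n j =
     euler_partial (2 * n) p * euler_partial_inverse p (int n + j) * euler_partial_inverse p (int n - j)"

lemma euler_partial_Suc: "euler_partial (Suc n) p = euler_partial n p * (1 - p ^ Suc n)"
  by (simp add: euler_partial_def)

lemma euler_partial_inverse_pred: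
  assumes "norm p < 1"
  shows "euler_partial_inverse p (m - 1) = (1 - p powi m) * euler_partial_inverse p m"
proof (cases "m \<ge> 1")
  case True
  then obtain k where m: "m = int (Suc k)" using zero_less_imp_eq_int[of m] by (metis gr0_implies_Suc int_one_le_iff_zero_less)
  have "nat (int (Suc k) - 1) = k" by simp
  moreover have "1 - p ^ Suc k \<noteq> 0" using power_Suc_neq_one[OF assms] by (simp del: power_Suc)
  moreover have "inverse e = y * inverse (e * y)" if "y \<noteq> 0" for e y :: complex
    using that by (simp add: field_simps)
  ultimately show ?thesis
    unfolding m euler_partial_inverse_def nat_int euler_partial_Suc power_int_of_nat
    by (simp del: power_Suc inverse_mult_distrib)
next
  case False
  \<comment> \<open>At \<open>m = 0\<close> the factor \<open>1 - p powi 0\<close> is 0; for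
    \<open>m < 0\<close> both sides carry the default value 0.\<close>
  thus ?thesis by (cases "m = 0") (auto simp: euler_partial_inverse_def)
qed

lemma gauss_binomial_eq_0: "\<bar>j\<bar> > int n \<Longrightarrow> gauss_binomial p n j = 0"
  by (auto simp: gauss_binomial_def euler_partial_inverse_def)

text \<open>Two q-Pascal steps in one, going from row \<open>2n\<close> to row \<open>2n + 2\<close>
  so that the centring is kept.\<close>

lemma gauss_binomial_Suc:
  assumes "norm p < 1" "p \<noteq> 0"
  shows "gauss_binomial p (Suc n) j = (1 + p ^ (2 * n + 1)) * gauss_binomial p n j +
    p powi (int n + 1 - j) * gauss_binomial p n (j - 1) +
    p powi (int n + 1 + j) * gauss_binomial p n (j + 1)"
proof -
  \<comment> \<open>All four binomials are multiples of
    \<open>euler_partial (2 * n) p * a * b\<close>. Since \<open>A * C = p^(2n+2)\<close>, a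
    polynomial identity in \<open>A\<close>, \<open>C\<close> and \<open>1/p\<close> is all that
    remains.\<close>
  define a where "a = euler_partial_inverse p (int n + 1 + j)"
  define b where "b = euler_partial_inverse p (int n + 1 - j)"
  define A where "A = p powi (int n + 1 + j)"
  define C where "C = p powi (int n + 1 - j)"
  note red = euler_partial_inverse_pred[OF assms(1)]
  have a1: "euler_partial_inverse p (int n + j) = (1 - A) * a"
    using red[of "int n + 1 + j"] by (simp add: a_def A_def)
  have a2: "euler_partial_inverse p (int n + j - 1) = (1 - A / p) * ((1 - A) * a)"
    using red[of "int n + j"] assms(2) unfolding a1 A_def by (simp add: power_int_add)
  have b1: "euler_partial_inverse p (int n - j) = (1 - C) * b"
    using red[of "int n + 1 - j"] by (simp add: b_def C_def)
  have b2: "euler_partial_inverse p (int n - j - 1) = (1 - C / p) * ((1 - C) * b)"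
    using red[of "int n - j"] assms(2) unfolding b1 C_def
    by (simp add: power_int_add power_int_diff)
  have "A * C = p powi (int (2 * n + 2))" unfolding A_def C_def using assms(2)
    by (subst power_int_add[symmetric]) (auto simp: algebra_simps)
  hence AC: "p ^ (2 * n + 2) = A * C" by (simp only: power_int_of_nat)
  have AC': "p ^ (2 * n + 1) = A * C / p" using AC assms(2) by (simp add: field_simps)
  have e: "euler_partial (2 * Suc n) p = euler_partial (2 * n) p * (1 - A * C / p) * (1 - A * C)"
    using AC AC' by (simp add: euler_partial_Suc)
  have j1: "gauss_binomial p n (j - 1) = euler_partial (2 * n) p * ((1 - A / p) * ((1 - A) * a)) * b"
    unfolding gauss_binomial_def b_def a2[symmetric] by (simp add: algebra_simps)
  have j2: "gauss_binomial p n (j + 1) = euler_partial (2 * n) p * a * ((1 - C / p) * ((1 - C) * b))"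
    unfolding gauss_binomial_def a_def b2[symmetric] by (simp add: algebra_simps)
  have j0: "gauss_binomial p n j = euler_partial (2 * n) p * ((1 - A) * a) * ((1 - C) * b)"
    unfolding gauss_binomial_def a1 b1 ..
  have j3: "gauss_binomial p (Suc n) j =
      euler_partial (2 * n) p * (1 - A * C / p) * (1 - A * C) * a * b"
    unfolding gauss_binomial_def e a_def b_def by (simp add: algebra_simps)
  show ?thesis
    unfolding j0 j1 j2 j3 AC' A_def[symmetric] C_def[symmetric]
    using assms(2) by (simp add: field_simps)
qed

text \<open>The terms of the finite Jacobi triple product at \<open>z = -1\<close>.\<close>
definition gauss_term :: "complex \<Rightarrow> nat \<Rightarrow> int \<Rightarrow> complex" where
  "gauss_term q n j = (-1) powi j * q powi (j\<^sup>2) * gauss_binomial (q\<^sup>2) n j"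

text \<open>In base \<open>q^2\<close> the Pascal weights complete the square,
  \<open>j^2 + 2(n + 1 - j) = (2n + 1) + (j - 1)^2\<close> and symmetrically for
  \<open>j + 1\<close>. The coefficients of the recurrence thereby become independent of
  \<open>j\<close>.\<close>

lemma gauss_term_Suc:
  assumes "norm q < 1" "q \<noteq> 0"
  shows "gauss_term q (Suc n) j = (1 + q ^ (4 * n + 2)) * gauss_term q n j -
    q ^ (2 * n + 1) * (gauss_term q n (j - 1) + gauss_term q n (j + 1))"
proof -
  have sq: "(q\<^sup>2) powi k = q powi (2 * k)" for k by (simp add: power_int_mult)
  have 1: "q powi (j\<^sup>2) * (q\<^sup>2) powi (int n + 1 - j) = q ^ (2 * n + 1) * q powi ((j - 1)\<^sup>2)"
  proof -
    have "q powi (j\<^sup>2) * (q\<^sup>2) powi (int n + 1 - j) = q powi (j\<^sup>2 + 2 * (int n + 1 - j))"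
      unfolding sq using assms(2) by (intro power_int_add[symmetric]) auto
    also have "j\<^sup>2 + 2 * (int n + 1 - j) = int (2 * n + 1) + (j - 1)\<^sup>2"
      by (simp add: power2_eq_square algebra_simps)
    finally show ?thesis using assms(2) by (simp only: power_int_add power_int_of_nat simp_thms)
  qed
  have 2: "q powi (j\<^sup>2) * (q\<^sup>2) powi (int n + 1 + j) = q ^ (2 * n + 1) * q powi ((j + 1)\<^sup>2)"
  proof -
    have "q powi (j\<^sup>2) * (q\<^sup>2) powi (int n + 1 + j) = q powi (j\<^sup>2 + 2 * (int n + 1 + j))"
      unfolding sq using assms(2) by (intro power_int_add[symmetric]) auto
    also have "j\<^sup>2 + 2 * (int n + 1 + j) = int (2 * n + 1) + (j + 1)\<^sup>2"
      by (simp add: power2_eq_square algebra_simps)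
    finally show ?thesis using assms(2) by (simp only: power_int_add power_int_of_nat simp_thms)
  qed
  have 3: "(q\<^sup>2) ^ (2 * n + 1) = q ^ (4 * n + 2)"
    unfolding power_mult[symmetric] by (rule arg_cong[where f = "\<lambda>k. q ^ k"]) simp
  have p0: "q\<^sup>2 \<noteq> 0" using assms(2) by simp
  have 4: "(-1) powi (j - 1) = - ((-1) powi j :: complex)"
      "(-1) powi (j + 1) = - ((-1) powi j :: complex)"
    by (auto simp: power_int_minus_left)
  have "gauss_term q (Suc n) j = (-1) powi j *
     ((1 + q ^ (4 * n + 2)) * (q powi (j\<^sup>2) * gauss_binomial (q\<^sup>2) n j) +
      (q powi (j\<^sup>2) * (q\<^sup>2) powi (int n + 1 - j)) * gauss_binomial (q\<^sup>2) n (j - 1) +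
      (q powi (j\<^sup>2) * (q\<^sup>2) powi (int n + 1 + j)) * gauss_binomial (q\<^sup>2) n (j + 1))"
    unfolding gauss_term_def gauss_binomial_Suc[OF norm_power2_less_one[OF assms(1)] p0] 3
    by (simp add: algebra_simps)
  also have "\<dots> = (1 + q ^ (4 * n + 2)) * gauss_term q n j -
    q ^ (2 * n + 1) * (gauss_term q n (j - 1) + gauss_term q n (j + 1))"
    unfolding 1 2 gauss_term_def 4 by (simp add: algebra_simps)
  finally show ?thesis .
qed

lemma gauss_term_summable: "gauss_term q n summable_on UNIV"
proof -
  have "gauss_term q n summable_on {- int n..int n}" by simp
  thus ?thesis
    by (rule summable_on_cong_neutral[THEN iffD1, rotated -1])
       (auto simp: gauss_term_def intro!: gauss_binomial_eq_0)
qed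

text \<open>Shifting \<open>j\<close> by one does not change a sum over all integers, so each step
  multiplies the sum by \<open>1 + q^(4n+2) - 2 q^(2n+1)\<close>, the square of
  \<open>1 - q^(2n+1)\<close>.\<close>

lemma gauss_term_sum:
  assumes "norm q < 1" "q \<noteq> 0"
  shows "infsum (gauss_term q n) UNIV = (\<Prod>k<n. 1 - q ^ (2 * k + 1)) ^ 2"
proof (induction n)
  case 0
  have "infsum (gauss_term q 0) UNIV = sum (gauss_term q 0) {0}"
    by (rule infsum_finite_support) (auto simp: gauss_term_def intro!: gauss_binomial_eq_0)
  also have "\<dots> = 1"
    by (simp add: gauss_term_def gauss_binomial_def euler_partial_inverse_def euler_partial_def)
  finally show ?case by simp
next
  case (Suc n)
  let ?f = "gauss_term q n"
  have s: "?f summable_on UNIV" by (rule gauss_term_summable)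
  have sh: "(\<lambda>j. ?f (j + c)) summable_on UNIV" "(\<Sum>\<^sub>\<infinity>j. ?f (j + c)) = infsum ?f UNIV" for c
  proof -
    have b: "bij_betw (\<lambda>j::int. j + c) UNIV UNIV"
      by (rule bij_betwI[where g = "\<lambda>j. j - c"]) auto
    show "(\<lambda>j. ?f (j + c)) summable_on UNIV" "(\<Sum>\<^sub>\<infinity>j. ?f (j + c)) = infsum ?f UNIV"
      using s by (simp_all only: summable_on_reindex_bij_betw[OF b] infsum_reindex_bij_betw[OF b])
  qed
  have s1: "((\<lambda>j. ?f (j + c)) has_sum infsum ?f UNIV) UNIV" for c
    using sh[of c] by (simp add: has_sum_iff)
  have "((\<lambda>j. (1 + q ^ (4 * n + 2)) * ?f (j + 0) + (-(q ^ (2 * n + 1))) * (?f (j + (-1)) + ?f (j + 1))) has_sum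
      ((1 + q ^ (4 * n + 2)) * infsum ?f UNIV + (-(q ^ (2 * n + 1))) * (infsum ?f UNIV + infsum ?f UNIV))) UNIV"
    by (intro has_sum_add has_sum_cmult_right s1)
  also have "(\<lambda>j. (1 + q ^ (4 * n + 2)) * ?f (j + 0) + (-(q ^ (2 * n + 1))) * (?f (j + (-1)) + ?f (j + 1))) =
      gauss_term q (Suc n)"
    by (rule ext, subst gauss_term_Suc) (use assms in auto)
  finally have "infsum (gauss_term q (Suc n)) UNIV =
     (1 + q ^ (4 * n + 2)) * infsum ?f UNIV + (-(q ^ (2 * n + 1))) * (infsum ?f UNIV + infsum ?f UNIV)"
    by (rule infsumI)
  also have "\<dots> = (1 - q ^ (2 * n + 1)) ^ 2 * infsum ?f UNIV"
  proof -
    have *: "(1 + y ^ 2) * t + (- y) * (t + t) = (1 - y) ^ 2 * t" for y t :: complex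
      by (simp add: power2_eq_square algebra_simps)
    have **: "q ^ (4 * n + 2) = (q ^ (2 * n + 1)) ^ 2"
      unfolding power_mult[symmetric] by (rule arg_cong[where f = "\<lambda>k. q ^ k"]) simp
    show ?thesis unfolding ** by (rule *)
  qed
  finally show ?case using Suc by (simp add: power_mult_distrib mult_ac)
qed

section \<open>Letting \<open>n\<close> tend to infinity in the finite identity\<close>

lemma euler_partial_inverse_bounded:
  assumes "norm p < 1"
  obtains C where "C \<ge> 0" "\<And>m. norm (euler_partial_inverse p m) \<le> C"
proof -
  have "(\<lambda>n. inverse (euler_partial n p)) \<longlonglongrightarrow> inverse (euler_phi p)"
    by (intro tendsto_inverse euler_partial_tendsto euler_phi_nonzero assms)
  hence "Bseq (\<lambda>n. inverse (euler_partial n p))" by (rule convergent_imp_Bseq[OF convergentI])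
  then obtain C where "C > 0" "\<And>n. norm (inverse (euler_partial n p)) \<le> C"
    by (auto simp: Bseq_def)
  thus ?thesis by (intro that[of C]) (auto simp: euler_partial_inverse_def)
qed

lemma euler_partial_inverse_tendsto:
  assumes "norm p < 1"
  shows "(\<lambda>n. euler_partial_inverse p (int n + j)) \<longlonglongrightarrow> inverse (euler_phi p)"
proof -
  have "filterlim (\<lambda>n. nat (int n + j)) at_top sequentially"
    unfolding filterlim_at_top
  proof
    fix Z
    show "\<forall>\<^sub>F n in sequentially. Z \<le> nat (int n + j)"
      using eventually_ge_at_top[of "Z + nat \<bar>j\<bar>"] by eventually_elim linarith
  qed
  hence "(\<lambda>n. inverse (euler_partial (nat (int n + j)) p)) \<longlonglongrightarrow> inverse (euler_phi p)"
    by (intro tendsto_inverse filterlim_compose[OF euler_partial_tendsto] euler_phi_nonzero assms)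
  moreover have "\<forall>\<^sub>F n in sequentially.
      inverse (euler_partial (nat (int n + j)) p) = euler_partial_inverse p (int n + j)"
    using eventually_ge_at_top[of "nat \<bar>j\<bar>"]
    by eventually_elim (auto simp: euler_partial_inverse_def)
  ultimately show ?thesis by (simp add: filterlim_cong)
qed

lemma gauss_binomial_tendsto:
  assumes "norm p < 1"
  shows "(\<lambda>n. gauss_binomial p n j) \<longlonglongrightarrow> inverse (euler_phi p)"
proof -
  have "(\<lambda>n. euler_partial (2 * n) p) \<longlonglongrightarrow> euler_phi p"
    using LIMSEQ_subseq_LIMSEQ[OF euler_partial_tendsto[OF assms], of "\<lambda>n. 2 * n"]
    by (simp add: o_def strict_mono_def)
  hence "(\<lambda>n. gauss_binomial p n j) \<longlonglongrightarrow> euler_phi p * inverse (euler_phi p) * inverse (euler_phi p)"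
    unfolding gauss_binomial_def
    using euler_partial_inverse_tendsto[OF assms, of j] euler_partial_inverse_tendsto[OF assms, of "-j"]
    by (auto intro!: tendsto_mult)
  thus ?thesis using euler_phi_nonzero[OF assms] by simp
qed

text \<open>Convergent sequences are bounded. One constant for all \<open>n\<close> and
  \<open>j\<close> is what the exchange of limit and sum requires.\<close>

lemma gauss_binomial_bounded:
  assumes "norm p < 1"
  obtains C where "C \<ge> 0" "\<And>n j. norm (gauss_binomial p n j) \<le> C"
proof -
  obtain C where C: "C \<ge> 0" "\<And>m. norm (euler_partial_inverse p m) \<le> C"
    using euler_partial_inverse_bounded[OF assms] by blast
  have "Bseq (\<lambda>n. euler_partial n p)"
    by (rule convergent_imp_Bseq[OF convergentI[OF euler_partial_tendsto[OF assms]]])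
  then obtain D where D: "D > 0" "\<And>n. norm (euler_partial n p) \<le> D"
    by (auto simp: Bseq_def)
  have "norm (gauss_binomial p n j) \<le> D * C * C" for n j
    unfolding gauss_binomial_def norm_mult using C D
    by (intro mult_mono) (auto simp: less_imp_le)
  thus ?thesis using C D by (intro that[of "D * C * C"]) auto
qed

text \<open>Dominated convergence for series: each term converges by
  \<open>gauss_binomial_tendsto\<close>, and the majorant \<open>C |q|^(|j|-1)\<close> makes the sum
  over \<open>j\<close> converge uniformly in \<open>n\<close>.\<close>

lemma gauss_term_sum_tendsto:
  assumes "norm q < 1"
  shows "(\<lambda>n. infsum (gauss_term q n) UNIV) \<longlonglongrightarrow> theta4 q * inverse (euler_phi (q\<^sup>2))"
proof (rule swap_uniform_limit')
  note q2 = norm_power2_less_one[OF assms]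
  define g where "g = (\<lambda>j::int. (-1) powi j * q powi (j\<^sup>2) * inverse (euler_phi (q\<^sup>2)))"
  obtain C where C: "C \<ge> 0" "\<And>n j. norm (gauss_binomial (q\<^sup>2) n j) \<le> C"
    using gauss_binomial_bounded[OF q2] by blast
  have pow: "q powi (j\<^sup>2) = q ^ nat (j\<^sup>2)" for j :: int by (simp add: power_int_def)
  show "\<forall>\<^sub>F X in finite_subsets_at_top UNIV. (\<lambda>n. \<Sum>j\<in>X. gauss_term q n j) \<longlonglongrightarrow> sum g X"
    unfolding gauss_term_def g_def
    by (intro always_eventually allI tendsto_sum tendsto_mult tendsto_const gauss_binomial_tendsto q2)
  have "(\<lambda>j::int. (-1) powi j * q powi (j\<^sup>2)) summable_on UNIV" unfolding pow
    by (rule abs_summable_summable, rule int_series_abs_summable[OF assms abs_minus_1_le_square norm_minus_one_powi])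
  hence "((\<lambda>j::int. (-1) powi j * q powi (j\<^sup>2)) has_sum theta4 q) UNIV"
    by (simp add: theta4_def)
  hence "(g has_sum (theta4 q * inverse (euler_phi (q\<^sup>2)))) UNIV"
    unfolding g_def by (rule has_sum_cmult_left)
  thus "(sum g \<longlongrightarrow> theta4 q * inverse (euler_phi (q\<^sup>2))) (finite_subsets_at_top UNIV)"
    by (simp add: has_sum_def)
  show "uniform_limit UNIV (\<lambda>X n. \<Sum>j\<in>X. gauss_term q n j) (\<lambda>n. infsum (gauss_term q n) UNIV)
      (finite_subsets_at_top UNIV)"
  proof (rule Weierstrass_m_test_general)
    show "(\<lambda>j::int. norm q ^ (nat \<bar>j\<bar> - 1) * C) summable_on UNIV"
      using summable_on_int_power_abs[of "norm q"] assms by (intro summable_on_cmult_left) auto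
    show "norm (gauss_term q n j) \<le> norm q ^ (nat \<bar>j\<bar> - 1) * C" for n j
      unfolding gauss_term_def pow norm_mult[of "_ * _"]
      by (intro mult_mono norm_int_series_term_le C abs_minus_1_le_square norm_minus_one_powi) (use assms in auto)
  qed
qed auto

lemma euler_partial_double:
  "euler_partial (2 * n) q = (\<Prod>k<n. 1 - q ^ (2 * k + 1)) * euler_partial n (q\<^sup>2)"
proof (induction n)
  case (Suc n)
  have "q ^ (2 * n + 2) = (q\<^sup>2) ^ Suc n" by (simp flip: power_mult del: power_Suc)
  with Suc show ?case by (simp add: euler_partial_Suc mult_ac)
qed (simp add: euler_partial_def)

text \<open>The product over odd exponents is \<open>(q; q)_(2n) / (q^2; q^2)_n\<close>, with limit
  \<open>euler_phi q / euler_phi (q^2)\<close>. Its square has the limit of the Gauss sums.\<close>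

theorem theta4_mult_euler_phi:
  assumes "norm q < 1"
  shows "theta4 q * euler_phi (q\<^sup>2) = euler_phi q ^ 2"
proof (cases "q = 0")
  case True
  thus ?thesis by (simp add: euler_phi_def)
next
  case False
  note q2 = norm_power2_less_one[OF assms]
  have "(\<lambda>n. euler_partial (2 * n) q) \<longlonglongrightarrow> euler_phi q"
    using LIMSEQ_subseq_LIMSEQ[OF euler_partial_tendsto[OF assms], of "\<lambda>n. 2 * n"]
    by (simp add: o_def strict_mono_def)
  hence "(\<lambda>n. (euler_partial (2 * n) q / euler_partial n (q\<^sup>2)) ^ 2) \<longlonglongrightarrow> (euler_phi q / euler_phi (q\<^sup>2)) ^ 2"
    by (intro tendsto_power tendsto_divide euler_partial_tendsto q2 euler_phi_nonzero)
  also have "(\<lambda>n. (euler_partial (2 * n) q / euler_partial n (q\<^sup>2)) ^ 2) =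
      (\<lambda>n. infsum (gauss_term q n) UNIV)"
    using euler_partial_nonzero[OF q2]
    by (simp add: gauss_term_sum[OF assms False] euler_partial_double)
  finally have "(euler_phi q / euler_phi (q\<^sup>2)) ^ 2 = theta4 q * inverse (euler_phi (q\<^sup>2))"
    using gauss_term_sum_tendsto[OF assms] by (rule LIMSEQ_unique)
  thus ?thesis using euler_phi_nonzero[OF q2] by (simp add: field_simps power2_eq_square)
qed

section \<open>Logarithmic derivatives of the theta functions\<close>

text \<open>Taken without the factor \<open>q\<close>: the \<open>L\<close> of the overview is
  \<open>q * theta3_log q\<close>. Thus comparison with \<open>theta2_reduced\<close> makes sense at
  \<open>q = 0\<close> too.\<close>

definition theta3_log :: "complex \<Rightarrow> complex" where
  "theta3_log q = deriv theta3 q / theta3 q"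

definition theta4_log :: "complex \<Rightarrow> complex" where
  "theta4_log q = deriv theta4 q / theta4 q"

section \<open>Iterating \<open>q -> q^2\<close>: invariance and absence of zeros\<close>

lemma iterated_squares_tendsto_0:
  fixes q :: complex
  assumes "norm q < 1"
  shows "(\<lambda>n. q ^ (2 ^ n)) \<longlonglongrightarrow> 0"
  using LIMSEQ_subseq_LIMSEQ[OF LIMSEQ_power_zero[OF assms], of "\<lambda>n. 2 ^ n"]
  by (simp add: o_def strict_mono_def)

lemma norm_iterated_square_less_one: "norm q < 1 \<Longrightarrow> norm (q ^ (2 ^ n)) < 1" for q :: complex
  by (simp add: norm_power power_less_one_iff)

text \<open>The value at \<open>q\<close> is also the value at every \<open>q ^ (2 ^ n)\<close>;
  these points tend to 0, where \<open>f\<close> is continuous.\<close>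

lemma squaring_invariant_eq_value_at_0:
  assumes "continuous_on (ball 0 1) f" "\<And>q::complex. norm q < 1 \<Longrightarrow> f (q\<^sup>2) = f q" "norm q < 1"
  shows "f q = (f 0 :: complex)"
proof -
  have "f (q ^ (2 ^ n)) = f q" for n
  proof (induction n)
    case (Suc n)
    have "q ^ (2 ^ Suc n) = (q ^ (2 ^ n))\<^sup>2" by (simp add: power_mult[symmetric] mult.commute)
    with Suc assms(2)[OF norm_iterated_square_less_one[OF assms(3), of n]] show ?case by simp
  qed simp
  moreover have "(\<lambda>n. f (q ^ (2 ^ n))) \<longlonglongrightarrow> f 0"
  proof (rule isCont_tendsto_compose[OF _ iterated_squares_tendsto_0[OF assms(3)]])
    show "isCont f 0" using assms(1) by (simp add: continuous_on_eq_continuous_at)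
  qed
  ultimately show ?thesis by (simp add: LIMSEQ_const_iff)
qed

lemma nonzero_by_iterated_squares:
  assumes "continuous_on (ball 0 1) f" "f 0 \<noteq> (0::complex)" "norm q < 1"
    "\<And>q::complex. norm q < 1 \<Longrightarrow> f q = 0 \<Longrightarrow> f (q\<^sup>2) = 0"
  shows "f q \<noteq> 0"
proof
  assume q: "f q = 0"
  have "f (q ^ (2 ^ n)) = 0" for n
  proof (induction n)
    case (Suc n)
    have "q ^ (2 ^ Suc n) = (q ^ (2 ^ n))\<^sup>2" by (simp add: power_mult[symmetric] mult.commute)
    with Suc assms(4)[OF norm_iterated_square_less_one[OF assms(3), of n]] show ?case by simp
  qed (use q in simp)
  moreover have "(\<lambda>n. f (q ^ (2 ^ n))) \<longlonglongrightarrow> f 0"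
  proof (rule isCont_tendsto_compose[OF _ iterated_squares_tendsto_0[OF assms(3)]])
    show "isCont f 0" using assms(1) by (simp add: continuous_on_eq_continuous_at)
  qed
  ultimately show False using assms(2) by (simp add: LIMSEQ_const_iff)
qed

text \<open>The case of \<open>theta4\<close> comes first: \<open>theta3\<close> then is a factor of
  the nonzero \<open>theta4 (q^2) ^ 2\<close>, and \<open>theta2_reduced\<close> propagates its
  zeros only once \<open>theta3\<close> is known to have none.\<close>

lemma theta4_nonzero:
  assumes "norm q < 1"
  shows "theta4 q \<noteq> 0"
proof (rule nonzero_by_iterated_squares[where f = theta4, OF _ _ assms])
  show "theta4 (q\<^sup>2) = 0" if "norm q < 1" "theta4 q = 0" for q
    using theta3_mult_theta4[OF that(1)] that(2) by simp
qed (auto intro: holomorphic_on_imp_continuous_on holomorphic_theta4)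

lemma theta3_nonzero: "norm q < 1 \<Longrightarrow> theta3 q \<noteq> 0"
  using theta3_mult_theta4[of q] theta4_nonzero[OF norm_power2_less_one, of q] by auto

lemma theta2_reduced_nonzero:
  assumes "norm q < 1"
  shows "theta2_reduced q \<noteq> 0"
proof (rule nonzero_by_iterated_squares[where f = theta2_reduced, OF _ _ assms])
  show "theta2_reduced (q\<^sup>2) = 0" if "norm q < 1" "theta2_reduced q = 0" for q
    using theta2_reduced_square[OF that(1)] that(2) theta3_nonzero[OF norm_power2_less_one[OF that(1)]]
    by simp
qed (auto intro: holomorphic_on_imp_continuous_on holomorphic_theta2_reduced)

text \<open>A difference of squares: the Landen identities evaluate it as \<open>4 q s^2 c^2\<close>
  with \<open>s = theta2_reduced (q^2)\<close>, \<open>c = theta3 (q^2)\<close>, and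
  \<open>2 s c\<close> is again a Landen square.\<close>

theorem jacobi_quartic_identity:
  assumes "norm q < 1"
  shows "theta3 q ^ 4 - theta4 q ^ 4 = theta2 q ^ 4"
proof -
  have "theta3 q ^ 4 - theta4 q ^ 4 = (theta3 q ^ 2) ^ 2 - (theta4 q ^ 2) ^ 2" by simp
  also have "\<dots> = q * (2 * theta2_reduced (q\<^sup>2) * theta3 (q\<^sup>2)) ^ 2"
    unfolding theta3_square[OF assms] theta4_square[OF assms] by algebra
  also have "\<dots> = theta2 q ^ 4"
    unfolding theta2_reduced_square[OF assms, symmetric] theta2_pow4 by simp
  finally show ?thesis .
qed

section \<open>Differentiating the Landen identities\<close>

lemma theta3_has_deriv: "norm q < 1 \<Longrightarrow> (theta3 has_field_derivative theta3_log q * theta3 q) (at q)"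
  using holomorphic_derivI[OF holomorphic_theta3, of q] theta3_nonzero[of q]
  by (simp add: theta3_log_def)

lemma theta4_has_deriv: "norm q < 1 \<Longrightarrow> (theta4 has_field_derivative theta4_log q * theta4 q) (at q)"
  using holomorphic_derivI[OF holomorphic_theta4, of q] theta4_nonzero[of q]
  by (simp add: theta4_log_def)

lemma has_field_derivative_at_square:
  fixes q :: complex
  assumes "(f has_field_derivative d) (at (q\<^sup>2))"
  shows "((\<lambda>z. f (z\<^sup>2)) has_field_derivative 2 * q * d) (at q)"
  by (rule DERIV_chain2[where f = f and g = "\<lambda>z. z\<^sup>2" and x = q, OF assms, THEN DERIV_cong])
     (auto intro!: derivative_eq_intros)

lemma derivs_eq_on_disc:
  assumes "\<And>z. norm z < 1 \<Longrightarrow> f z = g z" "norm q < 1"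
    "(f has_field_derivative d) (at q)" "(g has_field_derivative d') (at (q::complex))"
  shows "d = d'"
proof -
  have "(f has_field_derivative d') (at q)"
    by (rule has_field_derivative_transform_within_open[OF assms(4), of "ball 0 1"])
       (use assms in auto)
  with assms(3) show ?thesis by (rule DERIV_unique)
qed

text \<open>Logarithmic derivative of \<open>theta3_mult_theta4\<close>; the factor
  \<open>4 * q\<close> is 2 from the square times \<open>2 * q\<close> from the inner
  function.\<close>

lemma theta_log_sum:
  assumes "norm q < 1"
  shows "theta3_log q + theta4_log q = 4 * q * theta4_log (q\<^sup>2)"
proof -
  note q2 = norm_power2_less_one[OF assms]
  have "theta3 q * (theta4_log q * theta4 q) + theta3_log q * theta3 q * theta4 q =
      2 * theta4 (q\<^sup>2) * (2 * q * (theta4_log (q\<^sup>2) * theta4 (q\<^sup>2)))"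
  proof (rule derivs_eq_on_disc[of "\<lambda>z. theta3 z * theta4 z" "\<lambda>z. theta4 (z\<^sup>2) ^ 2", OF theta3_mult_theta4 assms])
    show "((\<lambda>z. theta3 z * theta4 z) has_field_derivative
        theta3 q * (theta4_log q * theta4 q) + theta3_log q * theta3 q * theta4 q) (at q)"
      by (rule derivative_eq_intros theta3_has_deriv theta4_has_deriv assms refl)+ simp
    show "((\<lambda>z. theta4 (z\<^sup>2) ^ 2) has_field_derivative
        2 * theta4 (q\<^sup>2) * (2 * q * (theta4_log (q\<^sup>2) * theta4 (q\<^sup>2)))) (at q)"
      by (rule derivative_eq_intros has_field_derivative_at_square theta4_has_deriv q2 refl)+ simp
  qed
  hence "(theta3 q * theta4 q) * (theta3_log q + theta4_log q) = theta4 (q\<^sup>2) ^ 2 * (4 * q * theta4_log (q\<^sup>2))"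
    by (simp add: algebra_simps power2_eq_square)
  thus ?thesis unfolding theta3_mult_theta4[OF assms] using theta4_nonzero[OF q2] by simp
qed

text \<open>Derivative of \<open>theta3^2 + theta4^2 = 2 theta3(q^2)^2\<close>. With
  \<open>theta_log_sum\<close> it determines both logarithmic derivatives at \<open>q^2\<close> from
  those at \<open>q\<close>.\<close>

lemma theta_log_weighted_sum:
  assumes "norm q < 1"
  shows "theta3 q ^ 2 * theta3_log q + theta4 q ^ 2 * theta4_log q =
    2 * q * (theta3 q ^ 2 + theta4 q ^ 2) * theta3_log (q\<^sup>2)"
proof -
  note q2 = norm_power2_less_one[OF assms]
  have s: "theta3 z ^ 2 + theta4 z ^ 2 = 2 * theta3 (z\<^sup>2) ^ 2" if "norm z < 1" for z
    using theta3_square[OF that] theta4_square[OF that] by simp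
  have "2 * theta3 q * (theta3_log q * theta3 q) + 2 * theta4 q * (theta4_log q * theta4 q) =
      2 * (2 * theta3 (q\<^sup>2) * (2 * q * (theta3_log (q\<^sup>2) * theta3 (q\<^sup>2))))"
  proof (rule derivs_eq_on_disc[of "\<lambda>z. theta3 z ^ 2 + theta4 z ^ 2" "\<lambda>z. 2 * theta3 (z\<^sup>2) ^ 2", OF s assms])
    show "((\<lambda>z. theta3 z ^ 2 + theta4 z ^ 2) has_field_derivative
        2 * theta3 q * (theta3_log q * theta3 q) + 2 * theta4 q * (theta4_log q * theta4 q)) (at q)"
      by (rule derivative_eq_intros theta3_has_deriv theta4_has_deriv assms refl)+ simp
    show "((\<lambda>z. 2 * theta3 (z\<^sup>2) ^ 2) has_field_derivative
        2 * (2 * theta3 (q\<^sup>2) * (2 * q * (theta3_log (q\<^sup>2) * theta3 (q\<^sup>2))))) (at q)"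
      by (rule derivative_eq_intros has_field_derivative_at_square theta3_has_deriv q2 refl)+ simp
  qed
  hence "2 * (theta3 q ^ 2 * theta3_log q + theta4 q ^ 2 * theta4_log q) =
      2 * (2 * q * (2 * theta3 (q\<^sup>2) ^ 2) * theta3_log (q\<^sup>2))"
    by (simp add: algebra_simps power2_eq_square[of "theta3 _"] power2_eq_square[of "theta4 _"])
  thus ?thesis unfolding s[OF assms] by (simp only: mult_cancel_left) simp
qed

lemma holomorphic_theta3_log: "theta3_log holomorphic_on ball 0 1"
  unfolding theta3_log_def[abs_def]
  by (intro holomorphic_intros holomorphic_theta3) (use theta3_nonzero in auto)

lemma holomorphic_theta4_log: "theta4_log holomorphic_on ball 0 1"
  unfolding theta4_log_def[abs_def]
  by (intro holomorphic_intros holomorphic_theta4) (use theta4_nonzero in auto)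

lemma theta_log_diff_at_0: "theta3_log 0 - theta4_log 0 = 4"
proof -
  have 0: "norm (0::complex) < 1" by simp
  have e: "theta3 z ^ 2 - theta4 z ^ 2 = z * (2 * theta2_reduced (z\<^sup>2) ^ 2)" if "norm z < 1" for z
    using theta3_square[OF that] theta4_square[OF that] by simp
  \<comment> \<open>Stated at \<open>0^2\<close> to fit
    \<open>has_field_derivative_at_square\<close>; the chain rule multiplies this derivative by
    0.\<close>
  have t: "(theta2_reduced has_field_derivative deriv theta2_reduced 0) (at (0\<^sup>2))"
    using holomorphic_derivI[OF holomorphic_theta2_reduced, of 0] by simp
  have "2 * theta3 0 * (theta3_log 0 * theta3 0) - 2 * theta4 0 * (theta4_log 0 * theta4 0) = 8"
  proof (rule derivs_eq_on_disc[OF e 0])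
    show "((\<lambda>z. theta3 z ^ 2 - theta4 z ^ 2) has_field_derivative
        2 * theta3 0 * (theta3_log 0 * theta3 0) - 2 * theta4 0 * (theta4_log 0 * theta4 0)) (at 0)"
      by (rule derivative_eq_intros theta3_has_deriv theta4_has_deriv 0 refl)+ simp
    show "((\<lambda>z. z * (2 * theta2_reduced (z\<^sup>2) ^ 2)) has_field_derivative 8) (at 0)"
      by (rule derivative_eq_intros has_field_derivative_at_square t refl)+ simp
  qed
  hence "2 * (theta3_log 0 - theta4_log 0) = 2 * 4" by (simp add: algebra_simps)
  thus ?thesis by (simp only: mult_cancel_left) simp
qed

theorem theta_log_diff:
  assumes "norm q < 1"
  shows "4 * (theta3_log q - theta4_log q) = theta2_reduced q ^ 4"
proof -
  define G where "G = (\<lambda>q. 4 * (theta3_log q - theta4_log q) / theta2_reduced q ^ 4)"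
  have "G q = G 0"
  proof (rule squaring_invariant_eq_value_at_0[OF _ _ assms])
    show "continuous_on (ball 0 1) G" unfolding G_def
      by (intro continuous_intros holomorphic_on_imp_continuous_on holomorphic_theta3_log
          holomorphic_theta4_log holomorphic_theta2_reduced) (use theta2_reduced_nonzero in auto)
    fix q :: complex assume q: "norm q < 1"
    show "G (q\<^sup>2) = G q"
    proof (cases "q = 0")
      case False
      note q2 = norm_power2_less_one[OF q]
      define x where "x = theta3 q ^ 2"
      define y where "y = theta4 q ^ 2"
      define s where "s = theta2_reduced (q\<^sup>2)"
      define c where "c = theta3 (q\<^sup>2)"
      have nz: "s \<noteq> 0" "c \<noteq> 0" using theta2_reduced_nonzero[OF q2] theta3_nonzero[OF q2]
        by (auto simp: s_def c_def)
      have xy: "x = c ^ 2 + q * s ^ 2" "y = c ^ 2 - q * s ^ 2"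
        using theta3_square[OF q] theta4_square[OF q] by (simp_all add: x_def y_def c_def s_def)
      have w: "x * theta3_log q + y * theta4_log q = 2 * q * (x + y) * theta3_log (q\<^sup>2)"
        using theta_log_weighted_sum[OF q] by (simp add: x_def y_def)
      \<comment> \<open>Subtract \<open>c^2\<close> times \<open>theta_log_sum\<close> from the
        weighted relation; since \<open>x - c^2 = q s^2\<close> and
        \<open>y - c^2 = - q s^2\<close>, only the difference of the logarithmic derivatives
        survives.\<close>
      have "2 * q * (2 * c ^ 2 * (theta3_log (q\<^sup>2) - theta4_log (q\<^sup>2))) =
          2 * q * (x + y) * theta3_log (q\<^sup>2) - c ^ 2 * (4 * q * theta4_log (q\<^sup>2))"
        unfolding xy by (simp add: algebra_simps)
      also have "\<dots> = (x - c ^ 2) * theta3_log q + (y - c ^ 2) * theta4_log q"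
        unfolding w[symmetric] theta_log_sum[OF q, symmetric] by (simp add: algebra_simps)
      also have "\<dots> = q * (s ^ 2 * (theta3_log q - theta4_log q))"
        unfolding xy by (simp add: algebra_simps)
      finally have "q * (4 * c ^ 2 * (theta3_log (q\<^sup>2) - theta4_log (q\<^sup>2))) = q * (s ^ 2 * (theta3_log q - theta4_log q))"
        by (simp only: mult_ac) simp
      hence *: "4 * c ^ 2 * (theta3_log (q\<^sup>2) - theta4_log (q\<^sup>2)) = s ^ 2 * (theta3_log q - theta4_log q)"
        using False by (simp only: mult_cancel_left) simp
      have t: "theta2_reduced q ^ 4 = 4 * s ^ 2 * c ^ 2"
      proof -
        have "theta2_reduced q ^ 4 = (theta2_reduced q ^ 2) ^ 2" by simp
        thus ?thesis unfolding theta2_reduced_square[OF q] s_def c_def by (simp add: power_mult_distrib)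
      qed
      have "G (q\<^sup>2) = 4 * c ^ 2 * (theta3_log (q\<^sup>2) - theta4_log (q\<^sup>2)) / (s ^ 4 * c ^ 2)"
        using nz by (simp add: G_def s_def)
      also have "\<dots> = G q"
        unfolding * G_def t using nz by (simp add: field_simps power2_eq_square power4_eq_xxxx)
      finally show ?thesis .
    qed simp
  qed
  \<comment> \<open>The value is \<open>4 * 4 / 2 ^ 4\<close>.\<close>
  also have "G 0 = 1" unfolding G_def theta_log_diff_at_0 by simp
  finally show ?thesis using theta2_reduced_nonzero[OF assms] by (simp add: G_def)
qed

text \<open>Logarithmic derivative of Gauss's product: with
  \<open>f = euler_phi' / euler_phi\<close> it is \<open>2 f(q) - 2 q f(q^2)\<close>, and
  \<open>12 q\<close> times this is a difference of two values of \<open>eisP - 1\<close>.\<close>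

lemma theta4_log_eq_eisP:
  assumes "norm q < 1"
  shows "12 * q * theta4_log q = eisP q - eisP (q\<^sup>2)"
proof -
  note q2 = norm_power2_less_one[OF assms]
  define f where "f = (\<lambda>q. deriv euler_phi q / euler_phi q)"
  have d: "(euler_phi has_field_derivative f z * euler_phi z) (at z)" if "norm z < 1" for z
    using holomorphic_derivI[OF holomorphic_euler_phi, of z] euler_phi_nonzero[of z] that
    by (simp add: f_def)
  have "theta4 q * (2 * q * (f (q\<^sup>2) * euler_phi (q\<^sup>2))) + theta4_log q * theta4 q * euler_phi (q\<^sup>2) =
      2 * euler_phi q * (f q * euler_phi q)"
  proof (rule derivs_eq_on_disc[OF theta4_mult_euler_phi assms])
    show "((\<lambda>z. theta4 z * euler_phi (z\<^sup>2)) has_field_derivative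
      theta4 q * (2 * q * (f (q\<^sup>2) * euler_phi (q\<^sup>2))) + theta4_log q * theta4 q * euler_phi (q\<^sup>2)) (at q)"
      by (rule derivative_eq_intros has_field_derivative_at_square theta4_has_deriv d assms q2 refl)+ simp
    show "((\<lambda>z. euler_phi z ^ 2) has_field_derivative 2 * euler_phi q * (f q * euler_phi q)) (at q)"
      by (rule derivative_eq_intros d assms refl)+ simp
  qed
  hence "(theta4 q * euler_phi (q\<^sup>2)) * (2 * q * f (q\<^sup>2) + theta4_log q) = euler_phi q ^ 2 * (2 * f q)"
    by (simp add: algebra_simps power2_eq_square)
  hence "euler_phi q ^ 2 * (2 * q * f (q\<^sup>2) + theta4_log q) = euler_phi q ^ 2 * (2 * f q)"
    unfolding theta4_mult_euler_phi[OF assms] .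
  hence log: "theta4_log q = 2 * f q - 2 * q * f (q\<^sup>2)"
    using euler_phi_nonzero[OF assms] by (simp only: mult_cancel_left) (simp add: algebra_simps)
  have P: "eisP z = 1 + 24 * z * f z" if "norm z < 1" for z
    using eisP_eq_logderiv_euler_phi[OF that] by (simp add: f_def)
  show ?thesis unfolding log P[OF assms] P[OF q2] by (simp add: algebra_simps power2_eq_square)
qed

section \<open>The differential system\<close>

lemma quarter_functional_equation_imp_0:
  assumes K: "K holomorphic_on ball 0 1" "K 0 = 0"
    and fe: "\<And>q::complex. norm q < 1 \<Longrightarrow> K q = 4 * K (q\<^sup>2)" and q: "norm q < 1"
  shows "K q = 0"
proof -
  define d where "d = deriv K 0"
  have "((\<lambda>w. K w / w) \<longlongrightarrow> d) (at 0)"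
    using holomorphic_derivI[OF K(1) open_ball, of 0] K(2) by (simp add: d_def has_field_derivative_iff)
  hence "((\<lambda>w. norm (K w / w)) \<longlongrightarrow> norm d) (at 0)" by (rule tendsto_norm)
  hence "\<forall>\<^sub>F w in at 0. norm (K w / w) < norm d + 1" by (rule order_tendstoD) simp
  hence "\<forall>\<^sub>F w in nhds 0. norm (K w) \<le> (norm d + 1) * norm w"
    unfolding eventually_at_filter
  proof eventually_elim
    case (elim w)
    thus ?case using K(2) by (cases "w = 0") (auto simp: norm_divide field_simps)
  qed
  hence ev: "\<forall>\<^sub>F n in sequentially. norm (K (q ^ (2 ^ n))) \<le> (norm d + 1) * norm (q ^ (2 ^ n))"
    using iterated_squares_tendsto_0[OF q] by (rule eventually_compose_filterlim)
  have it: "K q = 4 ^ n * K (q ^ (2 ^ n))" for n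
  proof (induction n)
    case (Suc n)
    have "q ^ (2 ^ Suc n) = (q ^ (2 ^ n))\<^sup>2" by (simp add: power_mult[symmetric] mult.commute)
    with Suc fe[OF norm_iterated_square_less_one[OF q, of n]] show ?case by simp
  qed simp
  \<comment> \<open>With \<open>m = 2^n\<close> and \<open>r = sqrt |q|\<close>, the bound
    \<open>4^n |q|^(2^n)\<close> equals \<open>(m r^m)^2\<close>, so its decay follows from that of
    the sequence \<open>m r^m\<close> along powers of 2.\<close>
  from ev have "\<forall>\<^sub>F n in sequentially. norm (K q) \<le> (norm d + 1) * (real (2 ^ n) * sqrt (norm q) ^ (2 ^ n)) ^ 2"
  proof eventually_elim
    case (elim n)
    have "norm (K q) = 4 ^ n * norm (K (q ^ (2 ^ n)))" using it[of n] by (simp add: norm_mult norm_power)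
    also have "\<dots> \<le> 4 ^ n * ((norm d + 1) * norm (q ^ (2 ^ n)))" using elim by (intro mult_left_mono) auto
    also have "(4::real) ^ n = real (2 ^ n) ^ 2" by (simp add: power2_eq_square flip: power_mult_distrib)
    also have "norm (q ^ (2 ^ n)) = (sqrt (norm q) ^ (2 ^ n)) ^ 2"
      by (simp add: norm_power power_mult[symmetric] mult.commute[of _ 2]) (simp add: power_mult)
    finally show ?case by (simp add: power_mult_distrib mult_ac)
  qed
  moreover have "(\<lambda>n. (norm d + 1) * (real (2 ^ n) * sqrt (norm q) ^ (2 ^ n)) ^ 2) \<longlonglongrightarrow> (norm d + 1) * 0 ^ 2"
  proof (intro tendsto_intros)
    have "(\<lambda>n. real n * sqrt (norm q) ^ n) \<longlonglongrightarrow> 0" using q by (intro powser_times_n_limit_0) auto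
    from LIMSEQ_subseq_LIMSEQ[OF this, of "\<lambda>n. 2 ^ n"]
    show "(\<lambda>n. real (2 ^ n) * sqrt (norm q) ^ (2 ^ n)) \<longlonglongrightarrow> 0" by (simp add: o_def strict_mono_def)
  qed
  ultimately have "norm (K q) \<le> (norm d + 1) * 0 ^ 2"
    by (intro tendsto_lowerbound) auto
  thus ?thesis by simp
qed

lemma theta3_log_eq:
  assumes "norm q < 1"
  shows "12 * q * theta3_log q = 12 * q * theta4_log q + 3 * (theta3 q ^ 4 - theta4 q ^ 4)"
proof -
  have "4 * q * (theta3_log q - theta4_log q) = theta3 q ^ 4 - theta4 q ^ 4"
    unfolding jacobi_quartic_identity[OF assms] theta2_pow4 theta_log_diff[OF assms, symmetric] by simp
  thus ?thesis by algebra
qed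

section \<open>Values at \<open>q^2\<close> expressed through values at \<open>q\<close>\<close>

lemma theta3_pow4_at_square:
  assumes "norm q < 1"
  shows "theta3 (q\<^sup>2) ^ 4 = (theta3 q ^ 2 + theta4 q ^ 2) ^ 2 / 4"
proof -
  have "theta3 q ^ 2 + theta4 q ^ 2 = 2 * theta3 (q\<^sup>2) ^ 2"
    using theta3_square[OF assms] theta4_square[OF assms] by simp
  thus ?thesis by (simp add: power_mult_distrib)
qed

lemma theta4_pow4_at_square:
  assumes "norm q < 1"
  shows "theta4 (q\<^sup>2) ^ 4 = theta3 q ^ 2 * theta4 q ^ 2"
  using arg_cong[OF theta3_mult_theta4[OF assms], of "\<lambda>z. z ^ 2"] by (simp add: power_mult_distrib)

lemma theta4_log_at_square:
  assumes "norm q < 1"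
  shows "12 * q\<^sup>2 * theta4_log (q\<^sup>2) = 6 * q * theta4_log q + 3 / 4 * (theta3 q ^ 4 - theta4 q ^ 4)"
proof -
  have "12 * q\<^sup>2 * theta4_log (q\<^sup>2) = 3 * q * (theta3_log q + theta4_log q)"
    unfolding theta_log_sum[OF assms] by (simp add: power2_eq_square)
  also have "\<dots> = (12 * q * theta3_log q) / 4 + 3 * q * theta4_log q" by (simp add: algebra_simps)
  finally show ?thesis unfolding theta3_log_eq[OF assms] by (simp add: field_simps)
qed

theorem eisP_at_2_eq:
  assumes "norm q < 1"
  shows "eisP_at 2 q = 12 * q * theta4_log q + 2 * theta3 q ^ 4 - theta4 q ^ 4"
proof -
  define D where "D = (\<lambda>q. 12 * q * theta4_log q + 2 * theta3 q ^ 4 - theta4 q ^ 4 - eisP (q\<^sup>2))"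
  have "D q = D 0"
  proof (rule squaring_invariant_eq_value_at_0[OF _ _ assms])
    have "(\<lambda>q. eisP (q\<^sup>2)) holomorphic_on ball 0 1"
      by (rule holomorphic_on_compose_gen[OF _ holomorphic_eisP, unfolded o_def])
         (auto intro!: holomorphic_intros norm_power2_less_one)
    thus "continuous_on (ball 0 1) D" unfolding D_def
      by (intro holomorphic_on_imp_continuous_on holomorphic_intros
          holomorphic_theta4_log holomorphic_theta3 holomorphic_theta4)
    fix q :: complex assume q: "norm q < 1"
    show "D (q\<^sup>2) = D q"
      \<comment> \<open>Gauss's relation at \<open>q^2\<close> trades \<open>eisP (q^4)\<close> for
        \<open>eisP (q^2)\<close> and doubles the term in \<open>theta4_log (q^2)\<close>. The
        weights 2 and -1 in \<open>D\<close> make the mixed products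
        \<open>theta3^2 theta4^2\<close> cancel.\<close>
      using theta4_log_at_square[OF q] theta4_log_eq_eisP[OF norm_power2_less_one[OF q]]
        theta3_pow4_at_square[OF q] theta4_pow4_at_square[OF q]
      unfolding D_def by (simp add: field_simps) algebra
  qed
  also have "D 0 = 0" by (simp add: D_def eisP_eq_logderiv_euler_phi)
  finally show ?thesis by (simp add: D_def eisP_at_def)
qed

lemma theta3_pow4_has_deriv:
  assumes "norm q < 1"
  shows "((\<lambda>z. theta3 z ^ 4) has_field_derivative 4 * theta3_log q * theta3 q ^ 4) (at q)"
  by (rule derivative_eq_intros theta3_has_deriv assms refl)+ (simp add: eval_nat_numeral)

lemma theta4_pow4_has_deriv:
  assumes "norm q < 1"
  shows "((\<lambda>z. theta4 z ^ 4) has_field_derivative 4 * theta4_log q * theta4 q ^ 4) (at q)"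
  by (rule derivative_eq_intros theta4_has_deriv assms refl)+ (simp add: eval_nat_numeral)

lemma euler_derivative_theta4_pow4:
  assumes "norm q < 1"
  shows "q * (4 * theta4_log q * theta4 q ^ 4) =
    theta4 q ^ 4 * (eisP_at 2 q - 2 * theta3 q ^ 4 + theta4 q ^ 4) / 3"
  unfolding eisP_at_2_eq[OF assms] by (simp add: field_simps)

lemma euler_derivative_theta3_pow4:
  assumes "norm q < 1"
  shows "q * (4 * theta3_log q * theta3 q ^ 4) =
    theta3 q ^ 4 * (eisP_at 2 q + theta3 q ^ 4 - 2 * theta4 q ^ 4) / 3"
proof -
  have "q * (4 * theta3_log q * theta3 q ^ 4) = (12 * q * theta3_log q) * theta3 q ^ 4 / 3" by simp
  thus ?thesis unfolding theta3_log_eq[OF assms] eisP_at_2_eq[OF assms] by (simp add: field_simps)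
qed

text \<open>Differentiating this relation yields the functional equation for the defect in the last
  differential equation.\<close>

lemma eisP_at_2_at_square:
  assumes "norm q < 1"
  shows "eisP_at 2 (q\<^sup>2) = eisP_at 2 q / 2 + (theta3 q ^ 4 + theta4 q ^ 4) / 4"
  unfolding eisP_at_2_eq[OF assms] eisP_at_2_eq[OF norm_power2_less_one[OF assms]]
    theta4_log_at_square[OF assms] theta3_pow4_at_square[OF assms] theta4_pow4_at_square[OF assms]
  by (simp add: field_simps) algebra

lemma holomorphic_eisP_at_2: "eisP_at 2 holomorphic_on ball 0 1"
  unfolding eisP_at_def[abs_def]
  by (rule holomorphic_on_compose_gen[OF _ holomorphic_eisP, unfolded o_def])
     (auto intro!: holomorphic_intros norm_power2_less_one)

text \<open>Here \<open>theta2 q ^ 8\<close> appears as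
  \<open>(theta3 q ^ 4 - theta4 q ^ 4) ^ 2\<close>, so that the defect \<open>K\<close> is visibly
  holomorphic.\<close>

theorem euler_derivative_eisP_at_2:
  assumes "norm q < 1"
  shows "12 * q * deriv (eisP_at 2) q =
    2 * eisP_at 2 q ^ 2 - theta3 q ^ 8 - theta4 q ^ 8 - (theta3 q ^ 4 - theta4 q ^ 4) ^ 2"
proof -
  define K where "K = (\<lambda>q. 12 * q * deriv (eisP_at 2) q -
    (2 * eisP_at 2 q ^ 2 - theta3 q ^ 8 - theta4 q ^ 8 - (theta3 q ^ 4 - theta4 q ^ 4) ^ 2))"
  have "K q = 0"
  proof (rule quarter_functional_equation_imp_0[OF _ _ _ assms])
    show "K holomorphic_on ball 0 1" unfolding K_def
      by (intro holomorphic_intros holomorphic_eisP_at_2 holomorphic_theta3 holomorphic_theta4) auto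
    show "K 0 = 0" by (simp add: K_def eisP_at_2_eq)
    fix q :: complex assume q: "norm q < 1"
    note q2 = norm_power2_less_one[OF q]
    define a where "a = theta3 q ^ 4"
    define b where "b = theta4 q ^ 4"
    define e where "e = eisP_at 2 q"
    define x where "x = theta3 q ^ 2"
    define y where "y = theta4 q ^ 2"
    have d: "(eisP_at 2 has_field_derivative deriv (eisP_at 2) z) (at z)" if "norm z < 1" for z
      using holomorphic_derivI[OF holomorphic_eisP_at_2, of z] that by simp
    have "2 * q * deriv (eisP_at 2) (q\<^sup>2) = deriv (eisP_at 2) q / 2 +
        (4 * theta3_log q * theta3 q ^ 4 + 4 * theta4_log q * theta4 q ^ 4) / 4"
    proof (rule derivs_eq_on_disc[OF eisP_at_2_at_square q])
      show "((\<lambda>z. eisP_at 2 (z\<^sup>2)) has_field_derivative 2 * q * deriv (eisP_at 2) (q\<^sup>2)) (at q)"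
        by (rule has_field_derivative_at_square[OF d[OF q2]])
      show "((\<lambda>z. eisP_at 2 z / 2 + (theta3 z ^ 4 + theta4 z ^ 4) / 4) has_field_derivative
        deriv (eisP_at 2) q / 2 + (4 * theta3_log q * theta3 q ^ 4 + 4 * theta4_log q * theta4 q ^ 4) / 4) (at q)"
        by (intro DERIV_add DERIV_cdivide d theta3_pow4_has_deriv theta4_pow4_has_deriv q)
    qed
    \<comment> \<open>The multiplier \<open>24 * q\<close> turns the left side into 4 times the
      leading term of \<open>K (q^2)\<close>.\<close>
    from arg_cong[OF this, of "\<lambda>z. 24 * q * z"]
    have "4 * (12 * q\<^sup>2 * deriv (eisP_at 2) (q\<^sup>2)) = 12 * q * deriv (eisP_at 2) q +
        6 * (q * (4 * theta3_log q * theta3 q ^ 4) + q * (4 * theta4_log q * theta4 q ^ 4))"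
      by (simp add: algebra_simps power2_eq_square)
    also have "\<dots> = 12 * q * deriv (eisP_at 2) q + 2 * (a * (e + a - 2 * b) + b * (e - 2 * a + b))"
      unfolding euler_derivative_theta3_pow4[OF q] euler_derivative_theta4_pow4[OF q]
      unfolding a_def[symmetric] b_def[symmetric] e_def[symmetric] by (simp add: field_simps)
    finally have 1: "4 * (12 * q\<^sup>2 * deriv (eisP_at 2) (q\<^sup>2)) = \<dots>" .
    have pow8: "z ^ 8 = (z ^ 4) ^ 2" for z :: complex by simp
    have ab: "a = x ^ 2" "b = y ^ 2" by (simp_all add: a_def b_def x_def y_def)
    \<comment> \<open>All values at \<open>q^2\<close> are now polynomials in \<open>e\<close>,
      \<open>x\<close>, \<open>y\<close>, with \<open>a = x^2\<close> and \<open>b = y^2\<close>, so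
      the functional equation reduces to algebra.\<close>
    have "4 * K (q\<^sup>2) = 12 * q * deriv (eisP_at 2) q + 2 * (a * (e + a - 2 * b) + b * (e - 2 * a + b)) -
      4 * (2 * (e / 2 + (a + b) / 4) ^ 2 - ((x + y) ^ 2 / 4) ^ 2 - (x * y) ^ 2 - ((x + y) ^ 2 / 4 - x * y) ^ 2)"
      unfolding K_def pow8 theta3_pow4_at_square[OF q] theta4_pow4_at_square[OF q]
        eisP_at_2_at_square[OF q] right_diff_distrib[of 4 "12 * _ * _"] 1
        x_def[symmetric] y_def[symmetric] a_def[symmetric] b_def[symmetric] e_def[symmetric] ..
    also have "\<dots> = 12 * q * deriv (eisP_at 2) q - (2 * e ^ 2 - a ^ 2 - b ^ 2 - (a - b) ^ 2)"
      unfolding ab by (simp add: field_simps) algebra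
    also have "\<dots> = K q"
      unfolding K_def pow8 a_def b_def e_def ..
    finally show "K q = 4 * K (q\<^sup>2)" ..
  qed
  thus ?thesis by (simp add: K_def)
qed

theorem theorem3p1:
  fixes q :: complex
  assumes "norm q < 1"
  shows
    "((\<lambda>z. theta3 z ^ 4) field_differentiable at q \<and>
      q * deriv (\<lambda>z. theta3 z ^ 4) q =
        1 / 3 * (theta2 q ^ 8 - theta4 q ^ 8 + theta3 q ^ 4 * eisP_at 2 q)) \<and>
     ((\<lambda>z. theta4 z ^ 4) field_differentiable at q \<and>
      q * deriv (\<lambda>z. theta4 z ^ 4) q =
        1 / 3 * (theta2 q ^ 8 - theta3 q ^ 8 + theta4 q ^ 4 * eisP_at 2 q)) \<and>
     ((\<lambda>z. theta2 z ^ 4) field_differentiable at q \<and>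
      q * deriv (\<lambda>z. theta2 z ^ 4) q =
        1 / 3 * (theta3 q ^ 8 - theta4 q ^ 8 + theta2 q ^ 4 * eisP_at 2 q)) \<and>
     ((\<lambda>z. eisP_at 2 z) field_differentiable at q \<and>
      q * deriv (\<lambda>z. eisP_at 2 z) q =
        (2 * eisP_at 2 q ^ 2 - theta2 q ^ 8 - theta3 q ^ 8 - theta4 q ^ 8) / 12)"
proof -
  note d3 = theta3_pow4_has_deriv[OF assms] and d4 = theta4_pow4_has_deriv[OF assms]
  \<comment> \<open>Differentiability across the branch cut of \<open>theta2\<close> and at 0 comes
    from Jacobi's identity, valid on the whole disc.\<close>
  have d2: "((\<lambda>z. theta2 z ^ 4) has_field_derivative
      4 * theta3_log q * theta3 q ^ 4 - 4 * theta4_log q * theta4 q ^ 4) (at q)"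
    by (rule has_field_derivative_transform_within_open[OF DERIV_diff[OF d3 d4], of "ball 0 1"])
       (use assms jacobi_quartic_identity in auto)
  have dP: "(\<lambda>z. eisP_at 2 z) field_differentiable at q"
    using holomorphic_on_imp_differentiable_at[OF holomorphic_eisP_at_2] assms by simp
  have pow8: "z ^ 8 = (z ^ 4) ^ 2" for z :: complex by simp
  note j = jacobi_quartic_identity[OF assms, symmetric]
  note e3 = euler_derivative_theta3_pow4[OF assms] and e4 = euler_derivative_theta4_pow4[OF assms]
  have "q * deriv (\<lambda>z. theta3 z ^ 4) q =
      1 / 3 * (theta2 q ^ 8 - theta4 q ^ 8 + theta3 q ^ 4 * eisP_at 2 q)"
    \<comment> \<open>With \<open>a = theta3^4\<close>, \<open>b = theta4^4\<close> and
      \<open>P = eisP_at 2 q\<close>, this is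
      \<open>a (P + a - 2 b) = (a - b)^2 - b^2 + a P\<close>.\<close>
    unfolding DERIV_imp_deriv[OF d3] e3 pow8 j by (simp add: field_simps) algebra
  moreover have "q * deriv (\<lambda>z. theta4 z ^ 4) q =
      1 / 3 * (theta2 q ^ 8 - theta3 q ^ 8 + theta4 q ^ 4 * eisP_at 2 q)"
    unfolding DERIV_imp_deriv[OF d4] e4 pow8 j by (simp add: field_simps) algebra
  moreover have "q * deriv (\<lambda>z. theta2 z ^ 4) q =
      1 / 3 * (theta3 q ^ 8 - theta4 q ^ 8 + theta2 q ^ 4 * eisP_at 2 q)"
    unfolding DERIV_imp_deriv[OF d2] right_diff_distrib e3 e4 pow8 j by (simp add: field_simps)
  moreover have "q * deriv (\<lambda>z. eisP_at 2 z) q =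
      (2 * eisP_at 2 q ^ 2 - theta2 q ^ 8 - theta3 q ^ 8 - theta4 q ^ 8) / 12"
    using euler_derivative_eisP_at_2[OF assms] unfolding pow8 j by (simp add: field_simps)
  ultimately show ?thesis
    using d2 d3 d4 dP by (auto simp: field_differentiable_def)
qed

end
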